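(* Let $a<b$ be real numbers, let $f,g:[a,b]\to\mathbb{R}$ be Lipschitz-continuous functions satisfying $f(t)<g(t)$ for all $t\in[a,b]$, and let $$\omega=\{(y_1,y_2)\in\mathbb{R}^2;\ a<y_1<b,\ f(y_1)<y_2<g(y_1)\}.$$ Let $\gamma_f\subset\partial\omega$ and $\gamma_g\subset\partial\omega$ denote the graphs of $f$ and $g$. Assume that the set $V(\omega)=V_H(\omega)\times V_3(\omega)$, where $V_H(\omega)\subset H^1(\omega)\times H^1(\omega)$ and $V_3(\omega)\subset H^2(\omega)$, satisfies the following two conditions: $$u_3\in V_3(\omega)\ \text{ and }\ \partial_\alpha u_3=0\text{ in }\omega\text{ for all }\alpha\in\{1,2\}\quad\text{imply}\quad u_3=0\text{ in }\omega,$$ and $$(u_\alpha)\in V_H(\omega)\quad\text{implies}\quad u_\alpha=0\text{ on }\gamma_f\cup\gamma_g\text{ for all }\alpha\in\{1,2\}.$$ Then the set $V(\omega)$ satisfies the following rigidity property: $$\boldsymbol{u}\in V(\omega)\ \text{ and }\ \boldsymbol{E}(\boldsymbol{u})=\boldsymbol{0}\text{ in }\omega\quad\text{imply}\quad\boldsymbol{u}=\boldsymbol{0}\text{ in }\omega.$$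
   Context: For $\boldsymbol{u}=(u_1,u_2,u_3)\in H^1(\omega)\times H^1(\omega)\times H^2(\omega)$, the symmetric matrix field $\boldsymbol{E}(\boldsymbol{u})=(E_{\alpha\beta}(\boldsymbol{u}))_{\alpha,\beta\in\{1,2\}}$ is defined by $$E_{\alpha\beta}(\boldsymbol{u})=\tfrac12(\partial_\alpha u_\beta+\partial_\beta u_\alpha+\partial_\alpha u_3\,\partial_\beta u_3),$$ where $\partial_\alpha=\partial/\partial y_\alpha$ are distributional derivatives. Boundary values are understood in the sense of traces. (A set $\omega$ of the form given in the claim is called "rectangle-like with respect to the vertical axis" in the paper.) *)

theory Defs
  imports "HOL-Analysis.Analysis"
begin

section \<open>Smooth functions and test functions\<close>

definition pderiv_at :: "'a::euclidean_space \<Rightarrow> ('a \<Rightarrow> real) \<Rightarrow> 'a \<Rightarrow> real" where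
  "pderiv_at i \<phi> x = frechet_derivative \<phi> (at x) i"

primrec iter_pderiv :: "'a::euclidean_space list \<Rightarrow> ('a \<Rightarrow> real) \<Rightarrow> 'a \<Rightarrow> real" where
  "iter_pderiv [] \<phi> = \<phi>"
| "iter_pderiv (i # is) \<phi> = pderiv_at i (iter_pderiv is \<phi>)"

text \<open>Differentiability of all iterated partial derivatives also makes all of them continuous,
  so this is \<open>C\<^sup>\<infinity>\<close> on the whole space.\<close>

definition smooth :: "('a::euclidean_space \<Rightarrow> real) \<Rightarrow> bool" where
  "smooth \<phi> \<longleftrightarrow> (\<forall>is \<in> lists Basis. \<forall>x. iter_pderiv is \<phi> differentiable (at x))"

definition test_functions :: "'a::euclidean_space set \<Rightarrow> ('a \<Rightarrow> real) set" where
  "test_functions U =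
     {\<phi>. smooth \<phi> \<and> compact (closure {x. \<phi> x \<noteq> 0}) \<and> closure {x. \<phi> x \<noteq> 0} \<subseteq> U}"


section \<open>Weak derivatives and Sobolev spaces\<close>

text \<open>Elements of Lebesgue and Sobolev spaces are represented by functions; two functions stand
  for the same element iff they agree almost everywhere. Values outside \<open>U\<close> are irrelevant.\<close>

definition locally_integrable :: "'a::euclidean_space set \<Rightarrow> ('a \<Rightarrow> real) \<Rightarrow> bool" where
  "locally_integrable U u \<longleftrightarrow>
     (\<forall>K. compact K \<and> K \<subseteq> U \<longrightarrow> integrable (lebesgue_on K) u)"

definition has_weak_pderiv ::
    "'a::euclidean_space set \<Rightarrow> 'a \<Rightarrow> ('a \<Rightarrow> real) \<Rightarrow> ('a \<Rightarrow> real) \<Rightarrow> bool" where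
  "has_weak_pderiv U i u v \<longleftrightarrow>
     locally_integrable U u \<and> locally_integrable U v \<and>
     (\<forall>\<phi> \<in> test_functions U.
        (LINT x|lebesgue_on U. u x * pderiv_at i \<phi> x) = - (LINT x|lebesgue_on U. v x * \<phi> x))"

text \<open>For open \<open>U\<close>, the choice is unique up to a null set whenever a weak derivative exists.\<close>

definition weak_pderiv ::
    "'a::euclidean_space set \<Rightarrow> 'a \<Rightarrow> ('a \<Rightarrow> real) \<Rightarrow> 'a \<Rightarrow> real" where
  "weak_pderiv U i u = (SOME v. has_weak_pderiv U i u v)"

definition L2 :: "'a measure \<Rightarrow> ('a \<Rightarrow> real) set" where
  "L2 M = {u. u \<in> borel_measurable M \<and> integrable M (\<lambda>x. (u x)\<^sup>2)}"

primrec sobolev_H :: "nat \<Rightarrow> 'a::euclidean_space set \<Rightarrow> ('a \<Rightarrow> real) set" where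
  "sobolev_H 0 U = L2 (lebesgue_on U)"
| "sobolev_H (Suc k) U =
     {u \<in> L2 (lebesgue_on U). \<forall>i\<in>Basis.
        (\<exists>v. has_weak_pderiv U i u v) \<and> weak_pderiv U i u \<in> sobolev_H k U}"

text \<open>\<open>has_trace U \<sigma> u h\<close>: for a measure \<open>\<sigma>\<close> carried by a Lipschitz part of the boundary
  of \<open>U\<close>, the trace of \<open>u \<in> H\<^sup>1(U)\<close> is \<open>h \<in> L\<^sup>2(\<sigma>)\<close>. This is the extension by continuity
  of the restriction map \<open>\<phi> \<mapsto> \<phi>|\<^sub>\<partial>\<^sub>U\<close> from the restrictions to \<open>U\<close> of functions in
  \<open>C\<^sub>c\<^sup>\<infinity>\<close> of the whole space, which are dense in \<open>H\<^sup>1(U)\<close>.\<close>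

definition has_trace ::
    "'a::euclidean_space set \<Rightarrow> 'a measure \<Rightarrow> ('a \<Rightarrow> real) \<Rightarrow> ('a \<Rightarrow> real) \<Rightarrow> bool" where
  "has_trace U \<sigma> u h \<longleftrightarrow>
     u \<in> sobolev_H 1 U \<and> h \<in> L2 \<sigma> \<and>
     (\<exists>\<phi>. (\<forall>n::nat. \<phi> n \<in> test_functions UNIV) \<and>
       (\<lambda>n. LINT x|lebesgue_on U. (\<phi> n x - u x)\<^sup>2) \<longlonglongrightarrow> 0 \<and>
       (\<forall>i\<in>Basis. (\<lambda>n. LINT x|lebesgue_on U. (pderiv_at i (\<phi> n) x - weak_pderiv U i u x)\<^sup>2)
          \<longlonglongrightarrow> 0) \<and>
       (\<lambda>n. LINT x|\<sigma>. (\<phi> n x - h x)\<^sup>2) \<longlonglongrightarrow> 0)"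


section \<open>Domains that are rectangle-like with respect to the vertical axis\<close>

definition rectangle_like ::
    "real \<Rightarrow> real \<Rightarrow> (real \<Rightarrow> real) \<Rightarrow> (real \<Rightarrow> real) \<Rightarrow> (real \<times> real) set" where
  "rectangle_like a b f g = {(y1, y2). a < y1 \<and> y1 < b \<and> f y1 < y2 \<and> y2 < g y1}"

text \<open>Arc length measure on the graph of a Lipschitz function over \<open>[a, b]\<close>. Such a function is
  differentiable almost everywhere, so the unspecified value of \<open>deriv\<close> at the remaining points
  does not matter.\<close>

definition graph_measure :: "real \<Rightarrow> real \<Rightarrow> (real \<Rightarrow> real) \<Rightarrow> (real \<times> real) measure" where
  "graph_measure a b f =
     distr (density (lebesgue_on {a..b}) (\<lambda>t. ennreal (sqrt (1 + (deriv f t)\<^sup>2)))) borel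
       (\<lambda>t. (t, f t))"


section \<open>The strain tensor\<close>

text \<open>The index set \<open>{1, 2}\<close> is the numeral type \<open>2\<close>, whose two elements are \<open>1\<close> and \<open>2\<close>.\<close>

definition unit_dir :: "2 \<Rightarrow> real \<times> real" where
  "unit_dir \<alpha> = (if \<alpha> = 1 then (1, 0) else (0, 1))"

abbreviation weak_d :: "(real \<times> real) set \<Rightarrow> 2 \<Rightarrow> (real \<times> real \<Rightarrow> real) \<Rightarrow> real \<times> real \<Rightarrow> real"
  where "weak_d \<omega> \<alpha> \<equiv> weak_pderiv \<omega> (unit_dir \<alpha>)"

definition strain ::
    "(real \<times> real) set \<Rightarrow> (2 \<Rightarrow> real \<times> real \<Rightarrow> real) \<times> (real \<times> real \<Rightarrow> real)
      \<Rightarrow> real \<times> real \<Rightarrow> real^2^2" where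
  "strain \<omega> u y = (case u of (uH, u3) \<Rightarrow>
     (\<chi> \<alpha> \<beta>. 1/2 * (weak_d \<omega> \<alpha> (uH \<beta>) y + weak_d \<omega> \<beta> (uH \<alpha>) y
               + weak_d \<omega> \<alpha> u3 y * weak_d \<omega> \<beta> u3 y)))"

end

theory Submission
  imports Defs
begin

text \<open>Where the strain vanishes, \<open>\<partial>\<^sub>2u\<^sub>2 = - (\<partial>\<^sub>2u\<^sub>3)\<^sup>2 / 2 \<le> 0\<close>, while \<open>u\<^sub>2\<close> vanishes at both ends of every
  vertical slice, so \<open>\<partial>\<^sub>2u\<^sub>2 = \<partial>\<^sub>2u\<^sub>3 = 0\<close> and then \<open>u\<^sub>2 = 0\<close>. The shear equation reduces to
  \<open>\<partial>\<^sub>2u\<^sub>1 = 0\<close>, hence \<open>u\<^sub>1 = 0\<close>, and the remaining equation gives \<open>\<partial>\<^sub>1u\<^sub>3 = 0\<close>.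

  The traces on the two graphs come with different approximating sequences. The slice identity is
  therefore used with weights that vanish on one graph each: a zero trace on the graph of \<open>f\<close>, resp.
  \<open>g\<close>, gives \<open>\<integral> (g - y\<^sub>2) \<partial>\<^sub>2u - u = 0\<close>, resp. \<open>\<integral> (f - y\<^sub>2) \<partial>\<^sub>2u - u = 0\<close>, and the difference of the
  two is \<open>\<integral> (g - f) \<partial>\<^sub>2u = 0\<close>. The first identity applied to \<open>u\<^sup>2\<close> shows that \<open>\<partial>\<^sub>2u = 0\<close> implies \<open>u = 0\<close>.\<close>

section \<open>Products of convergent sequences in \<open>L\<^sup>2\<close>\<close>

lemma L2_measurable: "u \<in> L2 M \<Longrightarrow> u \<in> borel_measurable M"
  and L2_integrable_square: "u \<in> L2 M \<Longrightarrow> integrable M (\<lambda>x. (u x)\<^sup>2)"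
  by (auto simp: L2_def)

lemma L2_integrable_mult:
  assumes "u \<in> L2 M" "v \<in> L2 M"
  shows "integrable M (\<lambda>x. u x * v x)"
proof (rule Bochner_Integration.integrable_bound)
  show "integrable M (\<lambda>x. (u x)\<^sup>2 + (v x)\<^sup>2)"
    using assms by (auto simp: L2_def)
  show "(\<lambda>x. u x * v x) \<in> borel_measurable M"
    using assms by (auto simp: L2_def)
  show "AE x in M. norm (u x * v x) \<le> norm ((u x)\<^sup>2 + (v x)\<^sup>2)"
  proof (rule AE_I2)
    fix x
    have "2 * (\<bar>u x\<bar> * \<bar>v x\<bar>) \<le> \<bar>u x\<bar>\<^sup>2 + \<bar>v x\<bar>\<^sup>2"
      using sum_squares_bound[of "\<bar>u x\<bar>" "\<bar>v x\<bar>"] by simp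
    moreover have "0 \<le> \<bar>u x\<bar> * \<bar>v x\<bar>" by simp
    ultimately have "\<bar>u x\<bar> * \<bar>v x\<bar> \<le> \<bar>u x\<bar>\<^sup>2 + \<bar>v x\<bar>\<^sup>2" by linarith
    then show "norm (u x * v x) \<le> norm ((u x)\<^sup>2 + (v x)\<^sup>2)"
      by (simp add: abs_mult del: abs_mult_self_eq)
  qed
qed

lemma L2_diff:
  assumes "u \<in> L2 M" "v \<in> L2 M"
  shows "(\<lambda>x. u x - v x) \<in> L2 M"
proof -
  have "integrable M (\<lambda>x. (u x)\<^sup>2 + (v x)\<^sup>2 - 2 * (u x * v x))"
    using assms L2_integrable_mult[OF assms] by (auto simp: L2_def)
  then show ?thesis
    using assms by (auto simp: L2_def power2_diff algebra_simps)
qed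

lemma L2_bounded_mult:
  assumes "u \<in> L2 M" "q \<in> borel_measurable M" "\<And>x. x \<in> space M \<Longrightarrow> \<bar>q x\<bar> \<le> B"
  shows "(\<lambda>x. q x * u x) \<in> L2 M"
proof -
  have "integrable M (\<lambda>x. (q x * u x)\<^sup>2)"
  proof (rule Bochner_Integration.integrable_bound)
    show "integrable M (\<lambda>x. B\<^sup>2 * (u x)\<^sup>2)"
      using assms by (auto simp: L2_def)
    show "(\<lambda>x. (q x * u x)\<^sup>2) \<in> borel_measurable M"
      using assms by (auto simp: L2_def)
    show "AE x in M. norm ((q x * u x)\<^sup>2) \<le> norm (B\<^sup>2 * (u x)\<^sup>2)"
    proof (rule AE_I2)
      fix x assume "x \<in> space M"
      then have "(q x)\<^sup>2 \<le> B\<^sup>2"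
        using assms(3) by (simp add: abs_le_square_iff[symmetric]) (metis abs_ge_self order_trans)
      then show "norm ((q x * u x)\<^sup>2) \<le> norm (B\<^sup>2 * (u x)\<^sup>2)"
        by (simp add: power_mult_distrib mult_right_mono)
    qed
  qed
  then show ?thesis
    using assms by (auto simp: L2_def)
qed

text \<open>The integral of \<open>(u + s * v)\<^sup>2\<close> is a quadratic polynomial in
  \<open>s\<close> without negative values; evaluating it at a suitable \<open>s\<close> gives the
  bound.\<close>

lemma L2_Cauchy_Schwarz:
  assumes "u \<in> L2 M" "v \<in> L2 M"
  shows "\<bar>LINT x|M. u x * v x\<bar> \<le> sqrt (LINT x|M. (u x)\<^sup>2) * sqrt (LINT x|M. (v x)\<^sup>2)"
proof -
  define A I C where "A = (LINT x|M. (u x)\<^sup>2)" and "I = (LINT x|M. u x * v x)"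
    and "C = (LINT x|M. (v x)\<^sup>2)"
  have quad: "0 \<le> A + 2 * s * I + s\<^sup>2 * C" for s
  proof -
    have "0 \<le> (LINT x|M. (u x + s * v x)\<^sup>2)"
      by simp
    also have "\<dots> = (LINT x|M. (u x)\<^sup>2 + 2 * s * (u x * v x) + s\<^sup>2 * (v x)\<^sup>2)"
      by (rule Bochner_Integration.integral_cong) (auto simp: power2_eq_square algebra_simps)
    also have "\<dots> = A + 2 * s * I + s\<^sup>2 * C"
      using L2_integrable_mult[OF assms] L2_integrable_square[OF assms(1)]
        L2_integrable_square[OF assms(2)] by (simp add: A_def I_def C_def)
    finally show ?thesis .
  qed
  have "C \<ge> 0" "A \<ge> 0" by (simp_all add: C_def A_def)
  have "I\<^sup>2 \<le> A * C"
  proof (cases "C = 0")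
    case True
    have "I = 0"
    proof (rule ccontr)
      assume "I \<noteq> 0"
      \<comment> \<open>For \<open>C = 0\<close> the polynomial is affine in \<open>s\<close>, and
        at this \<open>s\<close> it takes the value \<open>-1\<close>.\<close>
      then show False using quad[of "- (A + 1) / (2 * I)"] True by (simp add: field_simps)
    qed
    then show ?thesis using True by simp
  next
    case False
    then have "C > 0" using \<open>C \<ge> 0\<close> by simp
    \<comment> \<open>\<open>s = - I / C\<close> is the minimum point of the polynomial.\<close>
    have "0 \<le> A - I\<^sup>2 / C"
      using quad[of "- I / C"] \<open>C > 0\<close> by (simp add: power2_eq_square field_simps)
    then show ?thesis using \<open>C > 0\<close> by (simp add: field_simps)
  qed
  then have "\<bar>I\<bar> \<le> sqrt (A * C)"
    by (rule real_le_rsqrt[of "\<bar>I\<bar>", simplified])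
  then show ?thesis
    by (simp add: A_def I_def C_def real_sqrt_mult)
qed

text \<open>With \<open>P = p n - p'\<close> and \<open>R = r n - r'\<close>, the difference of the
  products is \<open>P * R + P * r' + p' * R\<close>. Cauchy-Schwarz bounds each integral by a
  product of two norms, at least one of which tends to 0.\<close>

lemma L2_tendsto_mult:
  assumes p: "\<And>n. p n \<in> L2 M" "p' \<in> L2 M" "(\<lambda>n. LINT x|M. (p n x - p' x)\<^sup>2) \<longlonglongrightarrow> 0"
    and r: "\<And>n. r n \<in> L2 M" "r' \<in> L2 M" "(\<lambda>n. LINT x|M. (r n x - r' x)\<^sup>2) \<longlonglongrightarrow> 0"
  shows "(\<lambda>n. LINT x|M. p n x * r n x) \<longlonglongrightarrow> (LINT x|M. p' x * r' x)"
proof -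
  let ?P = "\<lambda>n x. p n x - p' x"
  let ?R = "\<lambda>n x. r n x - r' x"
  have P: "?P n \<in> L2 M" and R: "?R n \<in> L2 M" for n
    using p r by (intro L2_diff; simp)+
  let ?S = "\<lambda>u. sqrt (LINT x|M. (u x)\<^sup>2)"
  have lim: "(\<lambda>n. ?S (?P n) * ?S (?R n) + ?S (?P n) * ?S r' + ?S p' * ?S (?R n)) \<longlonglongrightarrow> 0"
  proof -
    have "(\<lambda>n. ?S (?P n)) \<longlonglongrightarrow> sqrt 0" "(\<lambda>n. ?S (?R n)) \<longlonglongrightarrow> sqrt 0"
      using tendsto_real_sqrt[OF p(3)] tendsto_real_sqrt[OF r(3)] by simp_all
    then have "(\<lambda>n. ?S (?P n) * ?S (?R n) + ?S (?P n) * ?S r' + ?S p' * ?S (?R n))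
        \<longlonglongrightarrow> sqrt 0 * sqrt 0 + sqrt 0 * ?S r' + ?S p' * sqrt 0"
      by (intro tendsto_add tendsto_mult tendsto_const)
    then show ?thesis by simp
  qed
  have eq: "(LINT x|M. p n x * r n x) - (LINT x|M. p' x * r' x)
      = (LINT x|M. ?P n x * ?R n x) + (LINT x|M. ?P n x * r' x) + (LINT x|M. p' x * ?R n x)" for n
  proof -
    note i = L2_integrable_mult
    have "(LINT x|M. p n x * r n x) - (LINT x|M. p' x * r' x)
        = (LINT x|M. p n x * r n x - p' x * r' x)"
      by (rule Bochner_Integration.integral_diff[symmetric]) (intro i p r)+
    also have "\<dots> = (LINT x|M. ?P n x * ?R n x + ?P n x * r' x + p' x * ?R n x)"
      by (rule Bochner_Integration.integral_cong) (auto simp: algebra_simps)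
    also have "\<dots> = (LINT x|M. ?P n x * ?R n x) + (LINT x|M. ?P n x * r' x)
        + (LINT x|M. p' x * ?R n x)"
      using i[OF P R, of n n] i[OF P r(2), of n] i[OF p(2) R, of n] by simp
    finally show ?thesis .
  qed
  have "\<bar>(LINT x|M. p n x * r n x) - (LINT x|M. p' x * r' x)\<bar>
      \<le> ?S (?P n) * ?S (?R n) + ?S (?P n) * ?S r' + ?S p' * ?S (?R n)" for n
    unfolding eq using L2_Cauchy_Schwarz[OF P R, of n n] L2_Cauchy_Schwarz[OF P r(2), of n]
      L2_Cauchy_Schwarz[OF p(2) R, of n] by linarith
  then have "(\<lambda>n. (LINT x|M. p n x * r n x) - (LINT x|M. p' x * r' x)) \<longlonglongrightarrow> 0"
    by (intro Lim_null_comparison[OF _ lim]) auto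
  then show ?thesis by (simp add: LIM_zero_iff)
qed

text \<open>The weight is absorbed into the first factor, since multiplication by \<open>q\<close>
  enlarges squared \<open>L2\<close> distances by at most the factor
  \<open>B\<^sup>2\<close>.\<close>

lemma L2_tendsto_bounded_mult:
  assumes p: "\<And>n. p n \<in> L2 M" "p' \<in> L2 M" "(\<lambda>n. LINT x|M. (p n x - p' x)\<^sup>2) \<longlonglongrightarrow> 0"
    and r: "\<And>n. r n \<in> L2 M" "r' \<in> L2 M" "(\<lambda>n. LINT x|M. (r n x - r' x)\<^sup>2) \<longlonglongrightarrow> 0"
    and q: "q \<in> borel_measurable M" "\<And>x. x \<in> space M \<Longrightarrow> \<bar>q x\<bar> \<le> B"
  shows "(\<lambda>n. LINT x|M. q x * (p n x * r n x)) \<longlonglongrightarrow> (LINT x|M. q x * (p' x * r' x))"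
proof -
  have "(\<lambda>n. LINT x|M. (q x * p n x) * r n x) \<longlonglongrightarrow> (LINT x|M. (q x * p' x) * r' x)"
  proof (rule L2_tendsto_mult)
    show "\<And>n. (\<lambda>x. q x * p n x) \<in> L2 M" "(\<lambda>x. q x * p' x) \<in> L2 M"
      using L2_bounded_mult[OF _ q] p by auto
    have bound: "\<bar>LINT x|M. (q x * p n x - q x * p' x)\<^sup>2\<bar> \<le> B\<^sup>2 * (LINT x|M. (p n x - p' x)\<^sup>2)" for n
    proof -
      have d: "(\<lambda>x. p n x - p' x) \<in> L2 M" using p L2_diff by auto
      have "(LINT x|M. (q x * p n x - q x * p' x)\<^sup>2) \<le> (LINT x|M. B\<^sup>2 * (p n x - p' x)\<^sup>2)"
      proof (rule Bochner_Integration.integral_mono)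
        show "integrable M (\<lambda>x. (q x * p n x - q x * p' x)\<^sup>2)"
          using L2_integrable_square[OF L2_bounded_mult[OF d q]] by (simp add: right_diff_distrib)
        show "integrable M (\<lambda>x. B\<^sup>2 * (p n x - p' x)\<^sup>2)"
          using L2_integrable_square[OF d] by simp
        fix x assume "x \<in> space M"
        then have "(q x)\<^sup>2 \<le> B\<^sup>2"
          using q(2) by (simp add: abs_le_square_iff[symmetric]) (metis abs_ge_self order_trans)
        then have "(q x)\<^sup>2 * (p n x - p' x)\<^sup>2 \<le> B\<^sup>2 * (p n x - p' x)\<^sup>2"
          by (rule mult_right_mono) simp
        then show "(q x * p n x - q x * p' x)\<^sup>2 \<le> B\<^sup>2 * (p n x - p' x)\<^sup>2"
          by (simp add: power_mult_distrib[symmetric] right_diff_distrib)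
      qed
      then show ?thesis by simp
    qed
    show "(\<lambda>n. LINT x|M. (q x * p n x - q x * p' x)\<^sup>2) \<longlonglongrightarrow> 0"
      by (rule Lim_null_comparison[OF _ tendsto_mult_right_zero[OF p(3), of "B\<^sup>2"]])
        (use bound in auto)
  qed (use r in auto)
  then show ?thesis by (simp add: mult.assoc)
qed

section \<open>Partial derivatives of test functions\<close>

lemma bounded_on_compact:
  fixes h :: "'a::topological_space \<Rightarrow> real"
  assumes "continuous_on K h" "compact K"
  obtains B where "B \<ge> 0" "\<And>x. x \<in> K \<Longrightarrow> \<bar>h x\<bar> \<le> B"
proof -
  have "bounded (h ` K)"
    using assms by (intro compact_imp_bounded compact_continuous_image)
  then obtain B where "\<And>x. x \<in> K \<Longrightarrow> \<bar>h x\<bar> \<le> B"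
    unfolding bounded_iff real_norm_def by blast
  \<comment> \<open>The maximum with 0 makes the bound nonnegative even for empty
    \<open>K\<close>.\<close>
  then have "\<And>x. x \<in> K \<Longrightarrow> \<bar>h x\<bar> \<le> max 0 B" by (meson max.coboundedI2)
  then show ?thesis using that[of "max 0 B"] by simp
qed

lemma continuous_in_L2:
  fixes h :: "'a::euclidean_space \<Rightarrow> real"
  assumes "continuous_on UNIV h" "bounded U" "U \<in> sets lebesgue"
  shows "h \<in> L2 (lebesgue_on U)"
proof -
  interpret finite_measure "lebesgue_on U"
    using assms(2,3) by (intro finite_measure_lebesgue_on bounded_set_imp_lmeasurable)
  have meas: "h \<in> borel_measurable (lebesgue_on U)"
    using borel_measurable_continuous_onI[OF assms(1)] by (simp add: measurable_completion measurable_restrict_space1)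
  \<comment> \<open>\<open>U\<close> may fail to be closed, so the bound for \<open>h\<close> is
    taken on its compact closure.\<close>
  have "compact (closure U)" using assms(2) by simp
  from bounded_on_compact[OF continuous_on_subset[OF assms(1)] this]
  obtain B where "\<And>x. x \<in> closure U \<Longrightarrow> \<bar>h x\<bar> \<le> B" by auto
  then have B: "\<And>x. x \<in> U \<Longrightarrow> \<bar>h x\<bar> \<le> B" using closure_subset by auto
  have "integrable (lebesgue_on U) (\<lambda>x. (h x)\<^sup>2)"
  proof (rule integrable_const_bound[where B = "B\<^sup>2"])
    show "AE x in lebesgue_on U. norm ((h x)\<^sup>2) \<le> B\<^sup>2"
      using B by (intro AE_I2) (simp add: abs_le_square_iff[symmetric] order_trans[OF _ abs_ge_self])
  qed (use meas in auto)
  with meas show ?thesis by (simp add: L2_def)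
qed

lemma test_function_iter_pderiv:
  assumes "\<phi> \<in> test_functions U" "is \<in> lists Basis"
  shows "iter_pderiv is \<phi> differentiable (at x)" "continuous_on S (iter_pderiv is \<phi>)"
proof -
  show d: "iter_pderiv is \<phi> differentiable (at x)" for x
    using assms by (auto simp: test_functions_def smooth_def)
  show "continuous_on S (iter_pderiv is \<phi>)"
    by (rule differentiable_imp_continuous_on)
      (use d in \<open>auto simp: differentiable_on_def intro: differentiable_at_withinI\<close>)
qed

section \<open>One-variable derivatives and integrals of functions on the plane\<close>

lemma pderiv_at_snd_has_derivative:
  fixes \<phi> :: "real \<times> real \<Rightarrow> real"
  assumes "\<phi> differentiable (at (s, t))"
  shows "((\<lambda>y. \<phi> (s, y)) has_real_derivative pderiv_at (0, 1) \<phi> (s, t)) (at t)"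
proof -
  let ?F = "frechet_derivative \<phi> (at (s, t))"
  have F: "(\<phi> has_derivative ?F) (at (s, t))"
    using assms by (simp add: frechet_derivative_works)
  have "((\<lambda>y. (s, y)) has_derivative (\<lambda>h. (0, h))) (at t)"
    by (auto intro!: derivative_eq_intros)
  from has_derivative_compose[OF this F]
  have "((\<lambda>y. \<phi> (s, y)) has_derivative (\<lambda>h. ?F (0, h))) (at t)" .
  moreover have "(\<lambda>h. ?F (0, h)) = (*) (?F (0, 1))"
  proof
    fix h
    show "?F (0, h) = ?F (0, 1) * h"
      using linear_scale[OF has_derivative_linear[OF F], of h "(0, 1)"] by simp
  qed
  ultimately show ?thesis
    by (simp only: has_field_derivative_def pderiv_at_def)
qed

lemma pderiv_at_fst_has_derivative:
  fixes \<phi> :: "real \<times> real \<Rightarrow> real"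
  assumes "\<phi> differentiable (at (s, t))"
  shows "((\<lambda>x. \<phi> (x, t)) has_real_derivative pderiv_at (1, 0) \<phi> (s, t)) (at s)"
proof -
  let ?F = "frechet_derivative \<phi> (at (s, t))"
  have F: "(\<phi> has_derivative ?F) (at (s, t))"
    using assms by (simp add: frechet_derivative_works)
  have "((\<lambda>x. (x, t)) has_derivative (\<lambda>h. (h, 0))) (at s)"
    by (auto intro!: derivative_eq_intros)
  from has_derivative_compose[OF this F]
  have "((\<lambda>x. \<phi> (x, t)) has_derivative (\<lambda>h. ?F (h, 0))) (at s)" .
  moreover have "(\<lambda>h. ?F (h, 0)) = (*) (?F (1, 0))"
  proof
    fix h
    show "?F (h, 0) = ?F (1, 0) * h"
      using linear_scale[OF has_derivative_linear[OF F], of h "(1, 0)"] by simp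
  qed
  ultimately show ?thesis
    by (simp only: has_field_derivative_def pderiv_at_def)
qed

text \<open>Fubini makes the first variable the inner one, and there the fundamental theorem of
  calculus leaves only the values on the two vertical sides.\<close>

lemma integral_fst_derivative_zero:
  fixes F F' :: "real \<times> real \<Rightarrow> real"
  assumes "continuous_on UNIV F'"
    and deriv: "\<And>x y. ((\<lambda>x. F (x, y)) has_real_derivative F' (x, y)) (at x)"
    and zero: "\<And>y. F (p, y) = 0" "\<And>y. F (q, y) = 0"
  shows "(LINT x|lebesgue_on (cbox (p, c) (q, d)). F' x) = 0"
proof (cases "p \<le> q")
  case True
  have cont: "continuous_on S F'" for S
    using assms(1) continuous_on_subset by blast
  have inner: "integral (cbox p q) (\<lambda>x. F' (x, y)) = 0" for y
  proof -
    have "((\<lambda>x. F' (x, y)) has_integral F (q, y) - F (p, y)) {p..q}"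
      using deriv True
      by (intro fundamental_theorem_of_calculus)
        (auto simp: has_real_derivative_iff_has_vector_derivative[symmetric] intro: has_field_derivative_at_within)
    then show ?thesis using zero by (simp add: integral_unique)
  qed
  have "(LINT x|lebesgue_on (cbox (p, c) (q, d)). F' x) = integral (cbox (p, c) (q, d)) F'"
    by (intro lebesgue_integral_eq_integral continuous_imp_integrable cont) auto
  also have "\<dots> = integral (cbox p q) (\<lambda>x. integral (cbox c d) (\<lambda>y. F' (x, y)))"
    by (intro integral_prod_continuous cont)
  also have "\<dots> = integral (cbox c d) (\<lambda>y. integral (cbox p q) (\<lambda>x. F' (x, y)))"
    using cont by (intro integral_swap_continuous) (simp add: case_prod_unfold)
  finally show ?thesis by (simp only: inner) simp
next
  case False
  then have "cbox (p, c) (q, d) = {}" by (auto simp: cbox_Pair_eq)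
  then show ?thesis by (simp add: lebesgue_integral_eq_integral)
qed

lemma L2_tendsto_bounded:
  assumes "finite_measure M"
    and p: "\<And>n. p n \<in> L2 M" "p' \<in> L2 M" "(\<lambda>n. LINT x|M. (p n x - p' x)\<^sup>2) \<longlonglongrightarrow> 0"
    and q: "q \<in> borel_measurable M" "\<And>x. x \<in> space M \<Longrightarrow> \<bar>q x\<bar> \<le> B"
  shows "(\<lambda>n. LINT x|M. q x * p n x) \<longlonglongrightarrow> (LINT x|M. q x * p' x)"
proof -
  interpret finite_measure M by fact
  \<comment> \<open>On a finite measure space the constant 1 can serve as the second factor.\<close>
  have "(\<lambda>x. 1) \<in> L2 M" by (simp add: L2_def)
  then show ?thesis
    using L2_tendsto_bounded_mult[OF p, of "\<lambda>_ _. 1" "\<lambda>_. 1" q B] q by simp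
qed

section \<open>Closability of the horizontal derivative\<close>

text \<open>Integration by parts moves the derivative from \<open>\<phi> n\<close> onto a smooth
  weight, and \<open>\<phi> n\<close> tends to 0 in \<open>L2\<close>. The quadratic factor acts as
  a cutoff: it vanishes on the vertical sides of the box, and the horizontal sides give no boundary
  term for a derivative in the first variable.\<close>

lemma pderiv_limit_orthogonal:
  fixes \<phi> :: "nat \<Rightarrow> real \<times> real \<Rightarrow> real"
  assumes U: "bounded U" "U \<in> sets lebesgue" and box: "cbox (p, c) (q, d) \<subseteq> U"
    and \<phi>: "\<And>n. \<phi> n \<in> test_functions UNIV"
    and lim0: "(\<lambda>n. LINT x|lebesgue_on U. (\<phi> n x)\<^sup>2) \<longlonglongrightarrow> 0"
    and w: "w \<in> L2 (lebesgue_on U)"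
    and lim1: "(\<lambda>n. LINT x|lebesgue_on U. (pderiv_at (1, 0) (\<phi> n) x - w x)\<^sup>2) \<longlonglongrightarrow> 0"
    and \<psi>: "\<psi> \<in> test_functions UNIV"
  shows "(LINT x|lebesgue_on U. indicator (cbox (p, c) (q, d)) x * ((fst x - p) * (q - fst x))
           * pderiv_at (1, 0) \<psi> x * w x) = 0"
proof -
  let ?M = "lebesgue_on U" and ?R = "cbox (p, c) (q, d)"
  define D where "D = (\<lambda>u. pderiv_at (1, 0 :: real) (u :: real \<times> real \<Rightarrow> real))"
  define \<eta> where "\<eta> = (\<lambda>x :: real \<times> real. (fst x - p) * (q - fst x))"
  define k1 where "k1 = (\<lambda>x. \<eta> x * D \<psi> x)"
  \<comment> \<open>\<open>k2\<close> is the derivative of \<open>k1\<close> in the first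
    variable.\<close>
  define k2 where "k2 = (\<lambda>x. (p + q - 2 * fst x) * D \<psi> x + \<eta> x * D (D \<psi>) x)"
  have e1: "(1, 0) \<in> (Basis :: (real \<times> real) set)" by (simp add: Basis_prod_def)
  have contD: "continuous_on S u" "continuous_on S (D u)" "continuous_on S (D (D u))"
    and diff: "u differentiable (at x)" "D u differentiable (at x)"
    if "u \<in> test_functions UNIV" for u S x
    using test_function_iter_pderiv[OF that, of "[]"] test_function_iter_pderiv[OF that, of "[(1, 0)]"]
      test_function_iter_pderiv[OF that, of "[(1, 0), (1, 0)]"] e1 by (auto simp: D_def)
  have contk: "continuous_on S k1" "continuous_on S k2" for S
    unfolding k1_def k2_def \<eta>_def by (auto intro!: continuous_intros contD[OF \<psi>])
  have fin: "finite_measure ?M"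
    using U by (intro finite_measure_lebesgue_on bounded_set_imp_lmeasurable)
  have RU: "U \<inter> ?R = ?R" using box by blast
  have meas: "(\<lambda>x. indicator ?R x * k x) \<in> borel_measurable ?M"
    if "continuous_on UNIV k" for k :: "real \<times> real \<Rightarrow> real"
  proof -
    have "k \<in> borel_measurable borel" using that by (rule borel_measurable_continuous_onI)
    then have "(\<lambda>x. indicator ?R x * k x) \<in> borel_measurable borel" by measurable
    then show ?thesis by (simp add: measurable_completion measurable_restrict_space1)
  qed
  have bound: "\<exists>B. \<forall>x. \<bar>indicator ?R x * k x\<bar> \<le> B"
    if "continuous_on UNIV k" for k :: "real \<times> real \<Rightarrow> real"
  proof -
    have "continuous_on ?R k" using that continuous_on_subset by blast
    then obtain B where B: "B \<ge> 0" "\<And>x. x \<in> ?R \<Longrightarrow> \<bar>k x\<bar> \<le> B"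
      using bounded_on_compact compact_cbox by blast
    then have "\<bar>indicator ?R x * k x\<bar> \<le> B" for x by (cases "x \<in> ?R") auto
    then show ?thesis by blast
  qed
  obtain B1 B2 where B: "\<And>x. \<bar>indicator ?R x * k1 x\<bar> \<le> B1" "\<And>x. \<bar>indicator ?R x * k2 x\<bar> \<le> B2"
    using bound[OF contk(1)] bound[OF contk(2)] by blast
  have L2\<phi>: "\<phi> n \<in> L2 ?M" "D (\<phi> n) \<in> L2 ?M" for n
    using contD[OF \<phi>] U by (auto intro: continuous_in_L2)
  have parts: "(LINT x|?M. indicator ?R x * k1 x * D (\<phi> n) x)
      = - (LINT x|?M. indicator ?R x * k2 x * \<phi> n x)" for n
  proof -
    let ?F = "\<lambda>x. \<eta> x * D \<psi> x * \<phi> n x"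
    let ?F' = "\<lambda>x. k2 x * \<phi> n x + k1 x * D (\<phi> n) x"
    have i: "integrable ?M (\<lambda>x. indicator ?R x * k x * u x)"
      if "continuous_on UNIV k" "u \<in> L2 ?M" for k u
    proof -
      obtain B where B: "\<forall>x. \<bar>indicator ?R x * k x\<bar> \<le> B" using bound[OF \<open>continuous_on UNIV k\<close>] by blast
      have "(\<lambda>x. 1) \<in> L2 ?M" using fin by (simp add: L2_def finite_measure.integrable_const)
      from L2_integrable_mult[OF L2_bounded_mult[OF that(2) meas[OF that(1)]] this, of B] B
      show ?thesis by auto
    qed
    have "(LINT x|?M. indicator ?R x * k2 x * \<phi> n x) + (LINT x|?M. indicator ?R x * k1 x * D (\<phi> n) x)
        = (LINT x|?M. indicator ?R x * ?F' x)"
      using i[OF contk(2) L2\<phi>(1)] i[OF contk(1) L2\<phi>(2)]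
      by (subst Bochner_Integration.integral_add[symmetric]) (auto simp: algebra_simps)
    also have "\<dots> = (LINT x|lebesgue_on ?R. ?F' x)"
      using U(2) by (simp add: integral_restrict_space mult.assoc[symmetric] indicator_inter_arith[symmetric] RU)
    also have "\<dots> = 0"
    proof (rule integral_fst_derivative_zero[where F = ?F])
      show "continuous_on UNIV ?F'"
        by (intro continuous_intros contk contD[OF \<phi>])
      show "((\<lambda>x. ?F (x, y)) has_real_derivative ?F' (x, y)) (at x)" for x y
        unfolding \<eta>_def k1_def k2_def fst_conv D_def
        by (rule derivative_eq_intros pderiv_at_fst_has_derivative
            diff[OF \<phi>, unfolded D_def] diff[OF \<psi>, unfolded D_def] refl)+
          (simp add: algebra_simps)
    qed (simp_all add: \<eta>_def)
    finally show ?thesis by simp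
  qed
  \<comment> \<open>Now \<open>n\<close> tends to infinity in \<open>parts\<close>: the right side
    tends to 0, the left side to the integral against \<open>w\<close>.\<close>
  have "(\<lambda>n. LINT x|?M. indicator ?R x * k2 x * \<phi> n x) \<longlonglongrightarrow> (LINT x|?M. indicator ?R x * k2 x * 0)"
    by (rule L2_tendsto_bounded[OF fin L2\<phi>(1)]) (use lim0 meas[OF contk(2)] B in \<open>auto simp: L2_def\<close>)
  then have "(\<lambda>n. LINT x|?M. indicator ?R x * k1 x * D (\<phi> n) x) \<longlonglongrightarrow> 0"
    unfolding parts by (auto intro: tendsto_eq_intros)
  moreover have "(\<lambda>n. LINT x|?M. indicator ?R x * k1 x * D (\<phi> n) x)
      \<longlonglongrightarrow> (LINT x|?M. indicator ?R x * k1 x * w x)"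
    by (rule L2_tendsto_bounded[OF fin L2\<phi>(2) w]) (use lim1 meas[OF contk(1)] B in \<open>auto simp: D_def\<close>)
  ultimately have "(LINT x|?M. indicator ?R x * k1 x * w x) = 0"
    by (rule LIMSEQ_unique[symmetric])
  then show ?thesis by (simp add: k1_def \<eta>_def D_def mult.assoc)
qed

text \<open>Closability of \<open>\<partial>\<^sub>1\<close> in \<open>L\<^sup>2\<close>: \<open>w\<close> is orthogonal, with the weight \<open>\<eta>\<close> on a box, to every
  \<open>\<partial>\<^sub>1\<phi>\<^sub>m\<close>, hence to its own limit.\<close>

lemma pderiv_limit_zero:
  fixes \<phi> :: "nat \<Rightarrow> real \<times> real \<Rightarrow> real"
  assumes U: "bounded U" "open U"
    and \<phi>: "\<And>n. \<phi> n \<in> test_functions UNIV"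
    and lim0: "(\<lambda>n. LINT x|lebesgue_on U. (\<phi> n x)\<^sup>2) \<longlonglongrightarrow> 0"
    and w: "w \<in> L2 (lebesgue_on U)"
    and lim1: "(\<lambda>n. LINT x|lebesgue_on U. (pderiv_at (1, 0) (\<phi> n) x - w x)\<^sup>2) \<longlonglongrightarrow> 0"
  shows "AE x in lebesgue_on U. w x = 0"
proof -
  let ?M = "lebesgue_on U"
  have Ul: "U \<in> sets lebesgue" using U by auto
  have on_box: "AE x in ?M. x \<in> box (p, c) (q, d) \<longrightarrow> w x = 0"
    if box: "cbox (p, c) (q, d) \<subseteq> U" for p c q d
  proof -
    let ?R = "cbox (p, c) (q, d)"
    define \<eta> where "\<eta> = (\<lambda>x :: real \<times> real. indicator ?R x * ((fst x - p) * (q - fst x)))"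
    have meas: "\<eta> \<in> borel_measurable ?M"
    proof -
      have "\<eta> \<in> borel_measurable borel"
        unfolding \<eta>_def by (intro borel_measurable_times borel_measurable_indicator borel_measurable_continuous_onI
            continuous_intros) auto
      then show ?thesis by (simp add: measurable_completion measurable_restrict_space1)
    qed
    have cont: "continuous_on ?R (\<lambda>x. (fst x - p) * (q - fst x))" by (intro continuous_intros)
    obtain B where "B \<ge> 0" "\<And>x. x \<in> ?R \<Longrightarrow> \<bar>(fst x - p) * (q - fst x)\<bar> \<le> B"
      using bounded_on_compact[OF cont compact_cbox] by blast
    then have B: "\<bar>\<eta> x\<bar> \<le> B" for x by (cases "x \<in> ?R") (auto simp: \<eta>_def)
    have e1: "(1, 0) \<in> (Basis :: (real \<times> real) set)" by (simp add: Basis_prod_def)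
    have L2D: "pderiv_at (1, 0) (\<phi> n) \<in> L2 ?M" for n
      using test_function_iter_pderiv(2)[OF \<phi>, of "[(1, 0)]"] e1 U Ul by (auto intro: continuous_in_L2)
    have "(\<lambda>n. LINT x|?M. \<eta> x * (pderiv_at (1, 0) (\<phi> n) x * w x)) \<longlonglongrightarrow> (LINT x|?M. \<eta> x * (w x * w x))"
      by (rule L2_tendsto_bounded_mult[OF L2D w lim1 w w _ meas B]) simp
    \<comment> \<open>Orthogonality is applied with the approximant \<open>\<phi> n\<close> itself
      in the role of \<open>\<psi>\<close>.\<close>
    moreover have "(LINT x|?M. \<eta> x * (pderiv_at (1, 0) (\<phi> n) x * w x)) = 0" for n
      using pderiv_limit_orthogonal[OF U(1) Ul box \<phi> lim0 w lim1 \<phi>[of n]]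
      by (simp add: \<eta>_def mult.assoc)
    ultimately have 0: "(LINT x|?M. \<eta> x * (w x * w x)) = 0"
      by (simp add: LIMSEQ_const_iff)
    have nonneg: "0 \<le> \<eta> x" for x
      by (auto simp: \<eta>_def indicator_def cbox_Pair_eq)
    have int: "integrable ?M (\<lambda>x. \<eta> x * (w x * w x))"
      using L2_integrable_mult[OF L2_bounded_mult[OF w meas B] w] by (simp add: mult.assoc)
    have "AE x in ?M. \<eta> x * (w x * w x) = 0"
      using integral_nonneg_eq_0_iff_AE[OF int] nonneg 0 by simp
    then show ?thesis
    proof eventually_elim
      case (elim x)
      \<comment> \<open>The weight is zero on the vertical sides, so the conclusion is drawn on the
        open box.\<close>
      have "\<eta> x \<noteq> 0" if "x \<in> box (p, c) (q, d)"
      proof -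
        have "x \<in> ?R" using that box_subset_cbox by blast
        moreover have "p < fst x" "fst x < q"
          using that by (cases x; auto simp: box_def Basis_prod_def)+
        ultimately show ?thesis by (simp add: \<eta>_def)
      qed
      then show ?case using elim by auto
    qed
  qed
  \<comment> \<open>The exceptional null set depends on the box. By Lindelof countably many of these
    open boxes cover \<open>U\<close>, and a countable union of null sets is null.\<close>
  define \<F> where "\<F> = {box r s | r s. cbox r s \<subseteq> U}"
  have "\<Union>\<F> = U"
  proof
    show "\<Union>\<F> \<subseteq> U" using box_subset_cbox by (fastforce simp: \<F>_def)
    show "U \<subseteq> \<Union>\<F>"
    proof
      fix x assume "x \<in> U"
      then obtain r s where "cbox r s \<subseteq> U" "x \<in> box r s"
        using open_contains_cbox[OF U(2)] by metis
      then show "x \<in> \<Union>\<F>" unfolding \<F>_def by blast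
    qed
  qed
  moreover obtain \<G> where \<G>: "\<G> \<subseteq> \<F>" "countable \<G>" "\<Union>\<G> = \<Union>\<F>"
    by (rule Lindelof[of \<F>]) (auto simp: \<F>_def)
  ultimately have cover: "\<Union>\<G> = U" by simp
  have "\<forall>X\<in>\<G>. AE x in ?M. x \<in> X \<longrightarrow> w x = 0"
    using on_box \<G>(1) by (auto simp: \<F>_def)
  then have "AE x in ?M. \<forall>X\<in>\<G>. x \<in> X \<longrightarrow> w x = 0"
    unfolding AE_ball_countable[OF \<G>(2)] .
  moreover have "AE x in ?M. x \<in> U" by (intro AE_I2) simp
  ultimately show ?thesis
    by eventually_elim (use cover in blast)
qed

section \<open>Derivatives of Lipschitz functions and arc length\<close>

text \<open>This is the Cauchy criterion for the difference quotients at step 0. With tolerances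
  \<open>1 / Suc k\<close> and \<open>1 / Suc m\<close> the outer quantifiers are countable, the
  form from which Borel measurability can be read off.\<close>

lemma differentiable_iff_Cauchy:
  fixes F :: "real \<Rightarrow> real"
  shows "F differentiable (at t) \<longleftrightarrow>
    (\<forall>k::nat. \<exists>m::nat. \<forall>h h'. h \<noteq> 0 \<and> h' \<noteq> 0 \<and> \<bar>h\<bar> < 1 / Suc m \<and> \<bar>h'\<bar> < 1 / Suc m \<longrightarrow>
       \<bar>(F (t + h) - F t) / h - (F (t + h') - F t) / h'\<bar> \<le> 1 / Suc k)"
    (is "_ \<longleftrightarrow> (\<forall>k. \<exists>m. ?C k m)")
proof
  define q where "q = (\<lambda>h. (F (t + h) - F t) / h)"
  assume "F differentiable (at t)"
  then obtain D where D: "q \<midarrow>0\<rightarrow> D"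
    by (auto simp: real_differentiable_def DERIV_def q_def)
  show "\<forall>k. \<exists>m. ?C k m"
  proof
    fix k :: nat
    \<comment> \<open>Half of the tolerance is used, because two quotients are compared through
      \<open>D\<close>.\<close>
    obtain \<delta> where \<delta>: "\<delta> > 0" "\<And>h. h \<noteq> 0 \<Longrightarrow> \<bar>h\<bar> < \<delta> \<Longrightarrow> \<bar>q h - D\<bar> < 1 / (2 * Suc k)"
      using LIM_D[OF D, of "1 / (2 * Suc k)"] by auto
    obtain m :: nat where m: "1 / Suc m < \<delta>"
      using \<delta>(1) nat_approx_posE by blast
    have "\<bar>q h - q h'\<bar> \<le> 1 / Suc k"
      if "h \<noteq> 0" "h' \<noteq> 0" "\<bar>h\<bar> < 1 / Suc m" "\<bar>h'\<bar> < 1 / Suc m" for h h'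
    proof -
      have "\<bar>q h - D\<bar> < 1 / (2 * Suc k)" "\<bar>q h' - D\<bar> < 1 / (2 * Suc k)"
        using \<delta>(2) that m by auto
      then have "\<bar>q h - q h'\<bar> < 1 / (2 * Suc k) + 1 / (2 * Suc k)" by linarith
      also have "\<dots> = 1 / Suc k" by (simp add: field_simps)
      finally show ?thesis by simp
    qed
    then show "\<exists>m. ?C k m" unfolding q_def by blast
  qed
next
  define q where "q = (\<lambda>h. (F (t + h) - F t) / h)"
  assume "\<forall>k. \<exists>m. ?C k m"
  then have C: "\<exists>m::nat. \<forall>h h'. h \<noteq> 0 \<and> h' \<noteq> 0 \<and> \<bar>h\<bar> < 1 / Suc m \<and> \<bar>h'\<bar> < 1 / Suc m \<longrightarrow>
       \<bar>q h - q h'\<bar> \<le> 1 / Suc k" for k :: nat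
    by (auto simp: q_def)
  \<comment> \<open>The criterion asks for steps strictly below \<open>1 / Suc m\<close>, so the
    indices below start at \<open>Suc m\<close>.\<close>
  have small: "1 / real (Suc n) < 1 / real (Suc m)" if "n > m" for n m :: nat
    using that by (simp add: frac_less2)
  have "Cauchy (\<lambda>n. q (1 / Suc n))"
  proof (rule metric_CauchyI)
    fix e :: real assume "e > 0"
    then obtain k :: nat where k: "1 / Suc k < e" using nat_approx_posE by blast
    obtain m :: nat where m: "\<forall>h h'. h \<noteq> 0 \<and> h' \<noteq> 0 \<and> \<bar>h\<bar> < 1 / Suc m \<and> \<bar>h'\<bar> < 1 / Suc m \<longrightarrow>
       \<bar>q h - q h'\<bar> \<le> 1 / Suc k" using C by blast
    have "dist (q (1 / Suc i)) (q (1 / Suc j)) < e" if "i \<ge> Suc m" "j \<ge> Suc m" for i j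
      using m[rule_format, of "1 / Suc i" "1 / Suc j"] small[of m i] small[of m j] that k
      by (simp add: dist_real_def)
    then show "\<exists>M. \<forall>i\<ge>M. \<forall>j\<ge>M. dist (q (1 / Suc i)) (q (1 / Suc j)) < e" by blast
  qed
  then obtain D where D: "(\<lambda>n. q (1 / Suc n)) \<longlonglongrightarrow> D"
    using Cauchy_convergent convergent_def by blast
  have "q \<midarrow>0\<rightarrow> D"
  proof (rule LIM_I)
    fix e :: real assume "e > 0"
    then obtain k :: nat where k: "1 / Suc k < e" using nat_approx_posE by blast
    obtain m :: nat where m: "\<forall>h h'. h \<noteq> 0 \<and> h' \<noteq> 0 \<and> \<bar>h\<bar> < 1 / Suc m \<and> \<bar>h'\<bar> < 1 / Suc m \<longrightarrow>
       \<bar>q h - q h'\<bar> \<le> 1 / Suc k" using C by blast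
    \<comment> \<open>The second step runs through \<open>1 / Suc n\<close>, which turns the Cauchy
      estimate into one against the limit \<open>D\<close>.\<close>
    have "\<bar>q h - D\<bar> \<le> 1 / Suc k" if "h \<noteq> 0" "\<bar>h\<bar> < 1 / Suc m" for h
    proof (rule LIMSEQ_le_const2)
      show "(\<lambda>n. \<bar>q h - q (1 / Suc n)\<bar>) \<longlonglongrightarrow> \<bar>q h - D\<bar>"
        by (intro tendsto_intros D)
      have "\<bar>q h - q (1 / Suc n)\<bar> \<le> 1 / Suc k" if "n \<ge> Suc m" for n
        using m[rule_format, of h "1 / Suc n"] small[of m n] that \<open>h \<noteq> 0\<close> \<open>\<bar>h\<bar> < 1 / Suc m\<close> by simp
      then show "\<exists>N. \<forall>n\<ge>N. \<bar>q h - q (1 / Suc n)\<bar> \<le> 1 / Suc k" by blast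
    qed
    then show "\<exists>s>0. \<forall>h. h \<noteq> 0 \<and> norm (h - 0) < s \<longrightarrow> norm (q h - D) < e"
      using k by (intro exI[of _ "1 / Suc m"]) (auto intro: le_less_trans)
  qed
  then show "F differentiable (at t)"
    by (auto simp: real_differentiable_def DERIV_def q_def)
qed

text \<open>For fixed \<open>k\<close> and \<open>m\<close> the condition is an intersection of
  closed sets over all pairs of steps, hence closed although the steps are uncountably many. Only a
  countable union and a countable intersection remain.\<close>

lemma borel_differentiable_points:
  fixes F :: "real \<Rightarrow> real"
  assumes F: "continuous_on UNIV F"
  shows "{t. F differentiable (at t)} \<in> sets borel"
proof -
  let ?q = "\<lambda>h t. (F (t + h) - F t) / h"
  let ?C = "\<lambda>k m. {t. \<forall>h h'. h \<noteq> 0 \<and> h' \<noteq> 0 \<and> \<bar>h\<bar> < 1 / Suc m \<and> \<bar>h'\<bar> < 1 / Suc m \<longrightarrow>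
       \<bar>?q h t - ?q h' t\<bar> \<le> 1 / Suc k}"
  have q: "continuous_on UNIV (?q h)" if "h \<noteq> 0" for h
    using that by (intro continuous_intros continuous_on_compose2[OF F]) auto
  have "closed {t. h \<noteq> 0 \<and> h' \<noteq> 0 \<and> \<bar>h\<bar> < r \<and> \<bar>h'\<bar> < r \<longrightarrow> \<bar>?q h t - ?q h' t\<bar> \<le> c}" for h h' r c
  proof (cases "h \<noteq> 0 \<and> h' \<noteq> 0")
    case True
    then show ?thesis
      by (intro closed_Collect_imp open_Collect_const closed_Collect_le continuous_on_rabs
          continuous_on_diff q continuous_on_const) auto
  qed auto
  then have "closed (?C k m)" for k m :: nat
    by (intro closed_Collect_all)
  then have "(\<Inter>k. \<Union>m. ?C k m) \<in> sets borel" by auto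
  also have "(\<Inter>k. \<Union>m. ?C k m) = {t. F differentiable (at t)}"
    unfolding differentiable_iff_Cauchy by blast
  finally show ?thesis .
qed

text \<open>Where \<open>F\<close> is not differentiable, \<open>deriv\<close> takes the value of \<open>SOME\<close> on the empty predicate.\<close>

lemma deriv_not_differentiable:
  fixes F :: "real \<Rightarrow> real"
  assumes "\<not> F differentiable (at t)"
  shows "deriv F t = (SOME D. False)"
  using assms unfolding deriv_def real_differentiable_def by simp

text \<open>On the Borel set of differentiability points the derivative is the limit of the
  quotients with step \<open>1 / Suc n\<close>; elsewhere \<open>deriv\<close> is one fixed
  constant.\<close>

lemma borel_measurable_deriv:
  fixes F :: "real \<Rightarrow> real"
  assumes F: "continuous_on UNIV F"
  shows "deriv F \<in> borel_measurable borel"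
proof -
  let ?q = "\<lambda>n t. (F (t + 1 / Suc n) - F t) / (1 / Suc n)"
  have "deriv F = (\<lambda>t. if t \<in> {t. F differentiable (at t)} then lim (\<lambda>n. ?q n t) else (SOME D. False))"
  proof
    fix t
    show "deriv F t = (if t \<in> {t. F differentiable (at t)} then lim (\<lambda>n. ?q n t) else (SOME D. False))"
    proof (cases "F differentiable (at t)")
      case True
      then have "(F has_real_derivative deriv F t) (at t)"
        using DERIV_deriv_iff_real_differentiable by blast
      then have *: "((\<lambda>h. (F (t + h) - F t) / h) \<longlongrightarrow> deriv F t) (at 0)"
        by (simp add: DERIV_def)
      have "filterlim (\<lambda>n. 1 / real (Suc n)) (at 0) sequentially"
        using LIMSEQ_inverse_real_of_nat by (simp add: filterlim_at inverse_eq_divide)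
      from filterlim_compose[OF * this] have "(\<lambda>n. ?q n t) \<longlonglongrightarrow> deriv F t" .
      then show ?thesis using True by (simp add: limI)
    qed (simp add: deriv_not_differentiable)
  qed
  also have "\<dots> \<in> borel_measurable borel"
  proof (rule measurable_If_set)
    show "(\<lambda>t. lim (\<lambda>n. ?q n t)) \<in> borel_measurable borel"
      by (intro borel_measurable_lim_metric borel_measurable_continuous_onI continuous_intros
          continuous_on_compose2[OF F]) auto
    show "{t. F differentiable (at t)} \<inter> space borel \<in> sets borel"
      using borel_differentiable_points[OF F] by simp
  qed simp
  finally show ?thesis .
qed

section \<open>Derivatives of Lipschitz functions: bounds and measurability on an interval\<close>

lemma deriv_Lipschitz_bound:
  fixes F :: "real \<Rightarrow> real"
  assumes "L-lipschitz_on UNIV F"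
  shows "\<bar>deriv F t\<bar> \<le> max L \<bar>SOME D. False\<bar>"
proof (cases "F differentiable (at t)")
  case True
  then have "(F has_real_derivative deriv F t) (at t)"
    using DERIV_deriv_iff_real_differentiable by blast
  then have "((\<lambda>h. \<bar>(F (t + h) - F t) / h\<bar>) \<longlongrightarrow> \<bar>deriv F t\<bar>) (at 0)"
    unfolding DERIV_def by (rule tendsto_rabs)
  moreover have "\<bar>(F (t + h) - F t) / h\<bar> \<le> L" if "h \<noteq> 0" for h
    using lipschitz_onD[OF assms, of "t + h" t] that
    by (simp add: dist_real_def field_simps)
  then have "\<forall>\<^sub>F h in at 0. \<bar>(F (t + h) - F t) / h\<bar> \<le> L"
    by (simp add: eventually_at_filter)
  ultimately have "\<bar>deriv F t\<bar> \<le> L"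
    by (rule tendsto_upperbound) simp
  then show ?thesis by simp
\<comment> \<open>At the remaining points \<open>deriv\<close> has its default value, which is why
  the bound contains it.\<close>
qed (simp add: deriv_not_differentiable)

text \<open>Clamping the argument to \<open>{a..b}\<close> does not increase distances.\<close>

lemma Lipschitz_extension_interval:
  fixes f :: "real \<Rightarrow> real"
  assumes "L-lipschitz_on {a..b} f" "a \<le> b"
  shows "L-lipschitz_on UNIV (\<lambda>t. f (max a (min b t)))"
proof (rule lipschitz_onI)
  fix x y
  have "dist (f (max a (min b x))) (f (max a (min b y))) \<le> L * dist (max a (min b x)) (max a (min b y))"
    using assms by (intro lipschitz_onD[OF assms(1)]) auto
  also have "\<dots> \<le> L * dist x y"
    using lipschitz_on_nonneg[OF assms(1)]
    by (intro mult_left_mono) (auto simp: dist_real_def max_def min_def)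
  finally show "dist (f (max a (min b x))) (f (max a (min b y))) \<le> L * dist x y" .
qed (use lipschitz_on_nonneg[OF assms(1)] in auto)

text \<open>At the endpoints \<open>deriv f\<close> depends on values of \<open>f\<close> outside
  the interval, about which nothing is known. The endpoints are therefore treated as two separate
  points; near every interior point \<open>f\<close> agrees with its clamped extension, to which the
  results on the whole line apply.\<close>

lemma deriv_Lipschitz_interval:
  fixes f :: "real \<Rightarrow> real"
  assumes L: "L-lipschitz_on {a..b} f" and "a < b"
  shows "deriv f \<in> borel_measurable (lebesgue_on {a..b})"
    and "\<exists>B. \<forall>t\<in>{a..b}. \<bar>deriv f t\<bar> \<le> B"
proof -
  let ?F = "\<lambda>t. f (max a (min b t))"
  define G where "G = (\<lambda>t. if t = a then deriv f a else if t = b then deriv f b else deriv ?F t)"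
  have F: "L-lipschitz_on UNIV ?F"
    using Lipschitz_extension_interval[OF L] \<open>a < b\<close> by simp
  have G: "deriv f t = G t" if "t \<in> {a..b}" for t
  proof (cases "t = a \<or> t = b")
    case False
    then have "t \<in> {a<..<b}" using that by auto
    then have "\<forall>\<^sub>F x in nhds t. x \<in> {a<..<b}"
      by (intro eventually_nhds_in_open) auto
    then have "\<forall>\<^sub>F x in nhds t. f x = ?F x"
      by eventually_elim (simp add: max_def min_def)
    then have "deriv f t = deriv ?F t" by (rule deriv_cong_ev) simp
    then show ?thesis using False by (simp add: G_def)
  qed (auto simp: G_def)
  have "deriv ?F \<in> borel_measurable borel"
    by (rule borel_measurable_deriv[OF lipschitz_on_continuous_on[OF F]])
  then have "G \<in> borel_measurable borel"
    unfolding G_def by measurable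
  then have "G \<in> borel_measurable (lebesgue_on {a..b})"
    by (simp add: measurable_completion measurable_restrict_space1)
  then show "deriv f \<in> borel_measurable (lebesgue_on {a..b})"
    by (rule measurable_cong[THEN iffD2, rotated]) (simp add: G)
  have "\<bar>G t\<bar> \<le> max (max \<bar>deriv f a\<bar> \<bar>deriv f b\<bar>) (max L \<bar>SOME D. False\<bar>)" for t
    using deriv_Lipschitz_bound[OF F, of t] unfolding G_def by (auto simp: le_max_iff_disj)
  then show "\<exists>B. \<forall>t\<in>{a..b}. \<bar>deriv f t\<bar> \<le> B"
    using G by metis
qed

text \<open>The arc length density is at least 1. Convergence in \<open>L2\<close> along the graph
  thus passes to the parameter interval, where the slice integrals produce their boundary
  terms.\<close>

lemma integral_graph_measure_ge:
  fixes h :: "real \<times> real \<Rightarrow> real"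
  assumes L: "L-lipschitz_on {a..b} f" and "a < b"
    and h: "continuous_on UNIV h" "\<And>x. 0 \<le> h x"
  shows "(LINT t|lebesgue_on {a..b}. h (t, f t)) \<le> (LINT x|graph_measure a b f. h x)"
proof -
  let ?M = "lebesgue_on {a..b}"
  let ?d = "\<lambda>t. sqrt (1 + (deriv f t)\<^sup>2)"
  note cf = lipschitz_on_continuous_on[OF L]
  have "f \<in> borel_measurable ?M"
    by (rule continuous_imp_measurable_on_sets_lebesgue[OF cf]) simp
  moreover have "(\<lambda>t. t) \<in> borel_measurable ?M"
    by (rule continuous_imp_measurable_on_sets_lebesgue) auto
  ultimately have g: "(\<lambda>t. (t, f t)) \<in> borel_measurable ?M"
    by (rule borel_measurable_Pair[rotated])
  have d: "?d \<in> borel_measurable ?M"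
    using deriv_Lipschitz_interval(1)[OF L \<open>a < b\<close>] by measurable
  have hb: "h \<in> borel_measurable borel" using h(1) by (rule borel_measurable_continuous_onI)
  have hf: "continuous_on {a..b} (\<lambda>t. h (t, f t))"
    by (intro continuous_on_compose2[OF h(1)] continuous_intros cf) auto
  have int: "integrable ?M (\<lambda>t. h (t, f t))"
    by (rule continuous_imp_integrable_real[OF hf])
  have "(LINT x|graph_measure a b f. h x) = (LINT t|?M. ?d t * h (t, f t))"
    unfolding graph_measure_def using g d hb
    by (subst integral_distr) (auto simp: integral_density)
  moreover have "(LINT t|?M. h (t, f t)) \<le> (LINT t|?M. ?d t * h (t, f t))"
  proof (rule Bochner_Integration.integral_mono[OF int])
    \<comment> \<open>The upper bound on the density secures integrability; the integral of a
      non-integrable function would be 0 by convention.\<close>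
    obtain B where B: "\<And>t. t \<in> {a..b} \<Longrightarrow> \<bar>deriv f t\<bar> \<le> B"
      using deriv_Lipschitz_interval(2)[OF L \<open>a < b\<close>] by blast
    have dB: "?d t \<le> sqrt (1 + B\<^sup>2)" if "t \<in> {a..b}" for t
      using B[OF that] by (simp add: abs_le_square_iff[symmetric])
    show "integrable ?M (\<lambda>t. ?d t * h (t, f t))"
    proof (rule Bochner_Integration.integrable_bound)
      show "integrable ?M (\<lambda>t. sqrt (1 + B\<^sup>2) * h (t, f t))" using int by simp
      show "(\<lambda>t. ?d t * h (t, f t)) \<in> borel_measurable ?M" using d int by measurable
      show "AE t in ?M. norm (?d t * h (t, f t)) \<le> norm (sqrt (1 + B\<^sup>2) * h (t, f t))"
      proof (rule AE_I2)
        fix t assume "t \<in> space ?M"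
        then have "?d t * h (t, f t) \<le> sqrt (1 + B\<^sup>2) * h (t, f t)"
          using dB h(2) by (intro mult_right_mono) auto
        then show "norm (?d t * h (t, f t)) \<le> norm (sqrt (1 + B\<^sup>2) * h (t, f t))"
          using h(2) by (simp add: abs_mult)
      qed
    qed
    fix t
    show "h (t, f t) \<le> ?d t * h (t, f t)"
      using mult_right_mono[OF _ h(2), of 1 "?d t" "(t, f t)"] by simp
  qed
  ultimately show ?thesis by simp
qed

section \<open>Integration over vertical slices\<close>

locale graph_domain =
  fixes a b :: real and f g :: "real \<Rightarrow> real" and \<omega> :: "(real \<times> real) set"
  assumes ab: "a < b"
    and cont_f: "continuous_on {a..b} f" and cont_g: "continuous_on {a..b} g"
    and f_less_g: "\<And>t. t \<in> {a..b} \<Longrightarrow> f t < g t"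
    and \<omega>_def: "\<omega> = rectangle_like a b f g"
begin

lemma mem_\<omega>: "x \<in> \<omega> \<longleftrightarrow> a < fst x \<and> fst x < b \<and> f (fst x) < snd x \<and> snd x < g (fst x)"
  by (simp add: \<omega>_def rectangle_like_def case_prod_unfold)

lemma fst_in_interval: "x \<in> \<omega> \<Longrightarrow> fst x \<in> {a..b}"
  by (simp add: mem_\<omega>)

lemma open_\<omega>: "open \<omega>"
proof -
  let ?S = "{a<..<b} \<times> (UNIV :: real set)"
  have S: "open ?S" by (intro open_Times) auto
  have "continuous_on ?S (\<lambda>x. snd x - f (fst x))" "continuous_on ?S (\<lambda>x. g (fst x) - snd x)"
    by (intro continuous_intros continuous_on_compose2[OF cont_f] continuous_on_compose2[OF cont_g]; auto)+
  then have "open (?S \<inter> (\<lambda>x. snd x - f (fst x)) -` {0<..})" "open (?S \<inter> (\<lambda>x. g (fst x) - snd x) -` {0<..})"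
    using S by (auto intro!: continuous_open_preimage)
  then have "open ((?S \<inter> (\<lambda>x. snd x - f (fst x)) -` {0<..}) \<inter> (?S \<inter> (\<lambda>x. g (fst x) - snd x) -` {0<..}))"
    by (rule open_Int)
  also have "\<dots> = \<omega>" by (auto simp: mem_\<omega>)
  finally show ?thesis .
qed

lemma bounded_\<omega>: "bounded \<omega>"
proof -
  obtain Bf Bg where B: "\<And>t. t \<in> {a..b} \<Longrightarrow> \<bar>f t\<bar> \<le> Bf" "\<And>t. t \<in> {a..b} \<Longrightarrow> \<bar>g t\<bar> \<le> Bg"
    using bounded_on_compact[OF cont_f] bounded_on_compact[OF cont_g] by (metis compact_Icc)
  have "\<omega> \<subseteq> cbox (a, - Bf) (b, Bg)"
  proof
    fix x assume x: "x \<in> \<omega>"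
    show "x \<in> cbox (a, - Bf) (b, Bg)"
      using x B[OF fst_in_interval[OF x]] by (cases x) (auto simp: mem_\<omega> cbox_Pair_eq)
  qed
  then show ?thesis using bounded_cbox bounded_subset by blast
qed

lemma sets_\<omega>: "\<omega> \<in> sets borel" "\<omega> \<in> sets lebesgue"
  using open_\<omega> by auto

lemma finite_measure_\<omega>: "finite_measure (lebesgue_on \<omega>)"
  by (intro finite_measure_lebesgue_on bounded_set_imp_lmeasurable bounded_\<omega> sets_\<omega>)

text \<open>The closure of \<open>\<omega>\<close> is compact and lies in the closed strip over
  \<open>{a..b}\<close>. Continuity is asked for on the strip because weights built from
  \<open>f\<close> and \<open>g\<close> are known to be continuous only there.\<close>

lemma strip_bounded_measurable:
  fixes h :: "real \<times> real \<Rightarrow> real"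
  assumes h: "continuous_on ({a..b} \<times> UNIV) h"
  shows "h \<in> borel_measurable (lebesgue_on \<omega>)" "\<exists>B. \<forall>x\<in>\<omega>. \<bar>h x\<bar> \<le> B"
proof -
  have "\<omega> \<subseteq> {a..b} \<times> UNIV" by (auto simp: mem_\<omega>)
  then show "h \<in> borel_measurable (lebesgue_on \<omega>)"
    by (intro continuous_imp_measurable_on_sets_lebesgue continuous_on_subset[OF h] sets_\<omega>)
  have "closed ({a..b} \<times> (UNIV :: real set))" by (intro closed_Times) auto
  then have sub: "closure \<omega> \<subseteq> {a..b} \<times> UNIV"
    using \<open>\<omega> \<subseteq> _\<close> closure_minimal by blast
  have "compact (closure \<omega>)" using bounded_\<omega> by simp
  from bounded_on_compact[OF continuous_on_subset[OF h sub] this]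
  obtain B where "\<And>x. x \<in> closure \<omega> \<Longrightarrow> \<bar>h x\<bar> \<le> B" by metis
  then show "\<exists>B. \<forall>x\<in>\<omega>. \<bar>h x\<bar> \<le> B" using closure_subset by blast
qed

text \<open>Fubini is applied to \<open>h\<close> extended by 0 outside \<open>\<omega>\<close>,
  which is integrable because it is bounded with bounded support.\<close>

lemma integral_slices:
  fixes h :: "real \<times> real \<Rightarrow> real"
  assumes h: "continuous_on ({a..b} \<times> UNIV) h"
  shows "(LINT x|lebesgue_on \<omega>. h x)
    = (LINT t|lebesgue_on {a<..<b}. integral {f t..g t} (\<lambda>y. h (t, y)))"
proof -
  let ?I = "\<lambda>t. integral {f t..g t} (\<lambda>y. h (t, y))"
  define k where "k = (\<lambda>x. indicator \<omega> x * h x)"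
  obtain B where B: "\<And>x. x \<in> \<omega> \<Longrightarrow> \<bar>h x\<bar> \<le> B"
    using strip_bounded_measurable(2)[OF h] by blast
  have "continuous_on \<omega> h"
    by (rule continuous_on_subset[OF h]) (auto simp: mem_\<omega>)
  then have k: "k \<in> borel_measurable borel"
    using borel_measurable_continuous_on_indicator[OF sets_\<omega>(1), of h] by (simp add: k_def)
  have int: "integrable (lborel \<Otimes>\<^sub>M lborel) k"
    unfolding lborel_prod
  proof (rule integrableI_bounded_set[where A = \<omega> and B = B])
    show "emeasure lborel \<omega> < \<infinity>" using bounded_\<omega> by (rule emeasure_bounded_finite)
  qed (use k sets_\<omega> B in \<open>auto simp: k_def\<close>)
  have inner: "(LINT y|lborel. k (t, y)) = indicator {a<..<b} t * ?I t" for t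
  proof (cases "t \<in> {a<..<b}")
    case True
    have c: "continuous_on {f t..g t} (\<lambda>y. h (t, y))"
      using True by (intro continuous_on_compose2[OF h] continuous_intros) auto
    have "set_integrable lborel {f t..g t} (\<lambda>y. h (t, y))"
      unfolding set_integrable_def by (intro borel_integrable_compact c) simp
    \<comment> \<open>The slices of \<open>\<omega>\<close> are open intervals; their endpoints do
      not change the integral.\<close>
    then have "set_integrable lborel {f t<..<g t} (\<lambda>y. h (t, y))"
      by (rule set_integrable_subset) auto
    then have "(LINT y:{f t<..<g t}|lborel. h (t, y)) = ?I t"
      by (simp add: set_borel_integral_eq_integral integral_open_interval_real)
    moreover have "k (t, y) = indicator {f t<..<g t} y *\<^sub>R h (t, y)" for y
      using True by (auto simp: k_def mem_\<omega> indicator_def)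
    ultimately show ?thesis using True by (simp add: set_lebesgue_integral_def)
  next
    case False
    then have "k (t, y) = 0" for y by (auto simp: k_def mem_\<omega> indicator_def)
    then show ?thesis using False by simp
  qed
  have "(LINT x|lebesgue_on \<omega>. h x) = (LINT x|lborel. k x)"
    using sets_\<omega> k by (simp add: integral_restrict_space integral_completion k_def)
  also have "\<dots> = (LINT t|lborel. LINT y|lborel. k (t, y))"
    using lborel_pair.integral_fst'[OF int] by (simp add: lborel_prod)
  also have "\<dots> = (LINT t|lborel. indicator {a<..<b} t * ?I t)"
    by (simp only: inner)
  also have "\<dots> = (LINT t|lebesgue_on {a<..<b}. ?I t)"
  proof -
    have "(\<lambda>t. indicator {a<..<b} t * ?I t) \<in> borel_measurable lborel"
      using lborel_pair.integrable_fst'[OF int] unfolding inner by (rule borel_measurable_integrable)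
    then show ?thesis by (simp add: integral_restrict_space integral_completion)
  qed
  finally show ?thesis .
qed

text \<open>Integration of \<open>\<partial>\<^sub>2((c - y\<^sub>2) \<Phi>)\<close> over vertical slices; the weight vanishes on the graph of \<open>c\<close>.\<close>

lemma integral_weighted_slices:
  assumes \<Phi>: "continuous_on UNIV \<Phi>" and \<Psi>: "continuous_on UNIV \<Psi>"
    and deriv: "\<And>t y. ((\<lambda>y. \<Phi> (t, y)) has_real_derivative \<Psi> (t, y)) (at y)"
    and c: "continuous_on {a..b} c"
  shows "(LINT x|lebesgue_on \<omega>. (c (fst x) - snd x) * \<Psi> x - \<Phi> x)
    = (LINT t|lebesgue_on {a..b}. (c t - g t) * \<Phi> (t, g t) - (c t - f t) * \<Phi> (t, f t))"
proof -
  let ?K = "\<lambda>t. (c t - g t) * \<Phi> (t, g t) - (c t - f t) * \<Phi> (t, f t)"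
  have cK: "continuous_on {a..b} ?K"
    by (intro continuous_intros c cont_f cont_g continuous_on_compose2[OF \<Phi>]) auto
  have "(LINT x|lebesgue_on \<omega>. (c (fst x) - snd x) * \<Psi> x - \<Phi> x)
      = (LINT t|lebesgue_on {a<..<b}. integral {f t..g t} (\<lambda>y. (c t - y) * \<Psi> (t, y) - \<Phi> (t, y)))"
    by (subst integral_slices)
      (auto intro!: continuous_intros continuous_on_compose2[OF c] continuous_on_subset[OF \<Phi>]
        continuous_on_subset[OF \<Psi>])
  also have "\<dots> = (LINT t|lebesgue_on {a<..<b}. ?K t)"
  proof (rule Bochner_Integration.integral_cong[OF refl])
    fix t assume "t \<in> space (lebesgue_on {a<..<b})"
    then have "f t \<le> g t" using f_less_g[of t] by simp
    have "((\<lambda>y. (c t - y) * \<Psi> (t, y) - \<Phi> (t, y)) has_integral ?K t) {f t..g t}"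
    proof (rule fundamental_theorem_of_calculus[OF \<open>f t \<le> g t\<close>, where f = "\<lambda>y. (c t - y) * \<Phi> (t, y)"])
      fix y
      \<comment> \<open>The weight has derivative \<open>-1\<close> in \<open>y\<close>, which is
        the origin of the term \<open>- \<Phi> (t, y)\<close>.\<close>
      have "((\<lambda>y. (c t - y) * \<Phi> (t, y)) has_real_derivative (c t - y) * \<Psi> (t, y) - \<Phi> (t, y)) (at y)"
        by (rule derivative_eq_intros deriv refl)+ simp
      then show "((\<lambda>y. (c t - y) * \<Phi> (t, y)) has_vector_derivative (c t - y) * \<Psi> (t, y) - \<Phi> (t, y))
          (at y within {f t..g t})"
        by (simp add: has_real_derivative_iff_has_vector_derivative has_vector_derivative_at_within)
    qed
    then show "integral {f t..g t} (\<lambda>y. (c t - y) * \<Psi> (t, y) - \<Phi> (t, y)) = ?K t"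
      by (rule integral_unique)
  qed
  \<comment> \<open>The closed interval is the parameter domain of
    \<open>graph_measure\<close>.\<close>
  also have "\<dots> = (LINT t|lebesgue_on {a..b}. ?K t)"
  proof -
    have i: "integrable (lebesgue_on {a..b}) ?K"
      by (rule continuous_imp_integrable_real[OF cK])
    then have "set_integrable lebesgue {a..b} ?K"
      by (simp add: integrable_restrict_space set_integrable_def)
    then have "set_integrable lebesgue {a<..<b} ?K"
      by (rule set_integrable_subset) auto
    then have "integrable (lebesgue_on {a<..<b}) ?K"
      by (simp add: integrable_restrict_space set_integrable_def)
    then show ?thesis
      using i by (simp add: lebesgue_integral_eq_integral integral_open_interval_real)
  qed
  finally show ?thesis .
qed

end

section \<open>Vanishing traces and rigidity\<close>

text \<open>A zero trace is unpacked into one sequence that approximates the function and both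
  derivatives. Its boundary convergence is restated on the parameter interval, squeezed between 0
  and the arc length integral.\<close>

lemma has_trace_zeroE:
  fixes u :: "real \<times> real \<Rightarrow> real"
  assumes "has_trace U (graph_measure a b e) u (\<lambda>_. 0)"
    and e: "L-lipschitz_on {a..b} e" and "a < b"
  obtains \<phi> where "\<And>n. \<phi> n \<in> test_functions UNIV"
    and "u \<in> L2 (lebesgue_on U)" "weak_pderiv U (1, 0) u \<in> L2 (lebesgue_on U)"
    and "weak_pderiv U (0, 1) u \<in> L2 (lebesgue_on U)"
    and "(\<lambda>n. LINT x|lebesgue_on U. (\<phi> n x - u x)\<^sup>2) \<longlonglongrightarrow> 0"
    and "(\<lambda>n. LINT x|lebesgue_on U. (pderiv_at (1, 0) (\<phi> n) x - weak_pderiv U (1, 0) u x)\<^sup>2) \<longlonglongrightarrow> 0"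
    and "(\<lambda>n. LINT x|lebesgue_on U. (pderiv_at (0, 1) (\<phi> n) x - weak_pderiv U (0, 1) u x)\<^sup>2) \<longlonglongrightarrow> 0"
    and "(\<lambda>n. LINT t|lebesgue_on {a..b}. (\<phi> n (t, e t))\<^sup>2) \<longlonglongrightarrow> 0"
proof -
  have e12: "(1, 0) \<in> (Basis :: (real \<times> real) set)" "(0, 1) \<in> (Basis :: (real \<times> real) set)"
    by (simp_all add: Basis_prod_def)
  obtain \<phi> where \<phi>: "\<And>n. \<phi> n \<in> test_functions UNIV"
    and lim: "(\<lambda>n. LINT x|lebesgue_on U. (\<phi> n x - u x)\<^sup>2) \<longlonglongrightarrow> 0"
      "\<And>i. i \<in> Basis \<Longrightarrow>
        (\<lambda>n. LINT x|lebesgue_on U. (pderiv_at i (\<phi> n) x - weak_pderiv U i u x)\<^sup>2) \<longlonglongrightarrow> 0"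
      "(\<lambda>n. LINT x|graph_measure a b e. (\<phi> n x - 0)\<^sup>2) \<longlonglongrightarrow> 0"
    using assms(1) unfolding has_trace_def by blast
  have "u \<in> sobolev_H (Suc 0) U" using assms(1) by (simp add: has_trace_def)
  then have L2: "u \<in> L2 (lebesgue_on U)" "\<And>i. i \<in> Basis \<Longrightarrow> weak_pderiv U i u \<in> L2 (lebesgue_on U)"
    by simp_all
  have "(\<lambda>n. LINT t|lebesgue_on {a..b}. (\<phi> n (t, e t))\<^sup>2) \<longlonglongrightarrow> 0"
  proof (rule tendsto_sandwich[OF _ _ tendsto_const lim(3)])
    show "\<forall>\<^sub>F n in sequentially. 0 \<le> (LINT t|lebesgue_on {a..b}. (\<phi> n (t, e t))\<^sup>2)"
      by simp
    have "(LINT t|lebesgue_on {a..b}. (\<phi> n (t, e t))\<^sup>2) \<le> (LINT x|graph_measure a b e. (\<phi> n x)\<^sup>2)" for n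
      using test_function_iter_pderiv(2)[OF \<phi>, of "[]"]
      by (intro integral_graph_measure_ge[OF e \<open>a < b\<close>, where h = "\<lambda>x. (\<phi> n x)\<^sup>2"] continuous_intros) auto
    then show "\<forall>\<^sub>F n in sequentially. (LINT t|lebesgue_on {a..b}. (\<phi> n (t, e t))\<^sup>2)
        \<le> (LINT x|graph_measure a b e. (\<phi> n x - 0)\<^sup>2)"
      by simp
  qed
  then show ?thesis
    using that[OF \<phi> L2(1) L2(2)[OF e12(1)] L2(2)[OF e12(2)] lim(1) lim(2)[OF e12(1)] lim(2)[OF e12(2)]]
    by blast
qed

section \<open>Slice identities in the limit and their consequences for vanishing strain\<close>

context graph_domain
begin

abbreviation "D1 \<equiv> weak_pderiv \<omega> (1, 0)"
abbreviation "D2 \<equiv> weak_pderiv \<omega> (0, 1)"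

lemma test_function_L2:
  fixes \<phi> :: "real \<times> real \<Rightarrow> real"
  assumes "\<phi> \<in> test_functions UNIV"
  shows "\<phi> \<in> L2 (lebesgue_on \<omega>)" "pderiv_at (0, 1) \<phi> \<in> L2 (lebesgue_on \<omega>)"
    "continuous_on S \<phi>" "continuous_on S (pderiv_at (0, 1) \<phi>)" "\<phi> differentiable (at x)"
proof -
  have "(0, 1) \<in> (Basis :: (real \<times> real) set)" by (simp add: Basis_prod_def)
  then show *: "continuous_on S \<phi>" "continuous_on S (pderiv_at (0, 1) \<phi>)" "\<phi> differentiable (at x)" for S
    using test_function_iter_pderiv[OF assms, of "[]"] test_function_iter_pderiv[OF assms, of "[(0, 1)]"]
    by auto
  show "\<phi> \<in> L2 (lebesgue_on \<omega>)" "pderiv_at (0, 1) \<phi> \<in> L2 (lebesgue_on \<omega>)"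
    using * by (auto intro: continuous_in_L2 bounded_\<omega> sets_\<omega>)
qed

lemma graph_L2:
  fixes \<phi> :: "real \<times> real \<Rightarrow> real"
  assumes "\<phi> \<in> test_functions UNIV" "continuous_on {a..b} e"
  shows "(\<lambda>t. \<phi> (t, e t)) \<in> L2 (lebesgue_on {a..b})"
proof -
  have c: "continuous_on {a..b} (\<lambda>t. \<phi> (t, e t))"
    by (intro continuous_on_compose2[OF test_function_L2(3)[OF assms(1)]] continuous_intros assms(2)) auto
  then have "continuous_on {a..b} (\<lambda>t. (\<phi> (t, e t))\<^sup>2)" by (intro continuous_intros)
  then show ?thesis
    unfolding L2_def using c
    by (auto intro: continuous_imp_integrable_real continuous_imp_measurable_on_sets_lebesgue)
qed

lemma width_bounded_measurable:
  "(\<lambda>t. f t - g t) \<in> borel_measurable (lebesgue_on {a..b})" "\<exists>B. \<forall>t\<in>{a..b}. \<bar>f t - g t\<bar> \<le> B"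
proof -
  have c: "continuous_on {a..b} (\<lambda>t. f t - g t)" by (intro continuous_intros cont_f cont_g)
  then show "(\<lambda>t. f t - g t) \<in> borel_measurable (lebesgue_on {a..b})"
    by (intro continuous_imp_measurable_on_sets_lebesgue) auto
  show "\<exists>B. \<forall>t\<in>{a..b}. \<bar>f t - g t\<bar> \<le> B"
    using bounded_on_compact[OF c compact_Icc] by metis
qed

lemma weight_bounded_measurable:
  assumes "continuous_on {a..b} c"
  shows "(\<lambda>x. c (fst x) - snd x) \<in> borel_measurable (lebesgue_on \<omega>)"
    "\<exists>B. \<forall>x\<in>\<omega>. \<bar>c (fst x) - snd x\<bar> \<le> B"
proof -
  have "continuous_on ({a..b} \<times> UNIV) (\<lambda>x. c (fst x) - snd x)"
    by (intro continuous_intros continuous_on_compose2[OF assms]) auto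
  from strip_bounded_measurable[OF this]
  show "(\<lambda>x. c (fst x) - snd x) \<in> borel_measurable (lebesgue_on \<omega>)"
    "\<exists>B. \<forall>x\<in>\<omega>. \<bar>c (fst x) - snd x\<bar> \<le> B" by auto
qed

text \<open>For the approximants the slice identity has a boundary term on the graph of
  \<open>e\<close> alone, where they tend to 0 in \<open>L2\<close>. The area terms converge because
  the approximants and their vertical derivatives do.\<close>

lemma zero_trace_weighted_integral:
  assumes tr: "has_trace \<omega> (graph_measure a b e) u (\<lambda>_. 0)" and e: "L-lipschitz_on {a..b} e"
    and ce: "c = g \<and> e = f \<or> c = f \<and> e = g"
  shows "integrable (lebesgue_on \<omega>) (\<lambda>x. (c (fst x) - snd x) * D2 u x - u x)"
    and "(LINT x|lebesgue_on \<omega>. (c (fst x) - snd x) * D2 u x - u x) = 0"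
proof -
  obtain \<phi> where \<phi>: "\<And>n. \<phi> n \<in> test_functions UNIV"
    and L2: "u \<in> L2 (lebesgue_on \<omega>)" "D2 u \<in> L2 (lebesgue_on \<omega>)"
    and lim: "(\<lambda>n. LINT x|lebesgue_on \<omega>. (\<phi> n x - u x)\<^sup>2) \<longlonglongrightarrow> 0"
      "(\<lambda>n. LINT x|lebesgue_on \<omega>. (pderiv_at (0, 1) (\<phi> n) x - D2 u x)\<^sup>2) \<longlonglongrightarrow> 0"
      "(\<lambda>n. LINT t|lebesgue_on {a..b}. (\<phi> n (t, e t))\<^sup>2) \<longlonglongrightarrow> 0"
    by (rule has_trace_zeroE[OF tr e ab], rule that)
  let ?q = "\<lambda>x. c (fst x) - snd x"
  have cc: "continuous_on {a..b} c" and contE: "continuous_on {a..b} e" using ce cont_f cont_g by auto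
  obtain B where B: "\<And>x. x \<in> space (lebesgue_on \<omega>) \<Longrightarrow> \<bar>?q x\<bar> \<le> B"
    using weight_bounded_measurable(2)[OF cc] by auto
  note q = weight_bounded_measurable(1)[OF cc] B
  have one: "(\<lambda>x. 1) \<in> L2 (lebesgue_on \<omega>)"
    using finite_measure_\<omega> by (simp add: L2_def finite_measure.integrable_const)
  have int: "integrable (lebesgue_on \<omega>) (\<lambda>x. ?q x * v x)" "integrable (lebesgue_on \<omega>) w"
    if "v \<in> L2 (lebesgue_on \<omega>)" "w \<in> L2 (lebesgue_on \<omega>)" for v w
    using L2_integrable_mult[OF L2_bounded_mult[OF that(1) q] one] L2_integrable_mult[OF that(2) one] by simp_all
  then show "integrable (lebesgue_on \<omega>) (\<lambda>x. ?q x * D2 u x - u x)" using L2 by simp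
  have "(LINT x|lebesgue_on \<omega>. ?q x * pderiv_at (0, 1) (\<phi> n) x - \<phi> n x)
      = (LINT t|lebesgue_on {a..b}. (f t - g t) * \<phi> n (t, e t))" for n
  proof -
    have "(LINT x|lebesgue_on \<omega>. ?q x * pderiv_at (0, 1) (\<phi> n) x - \<phi> n x)
        = (LINT t|lebesgue_on {a..b}. (c t - g t) * \<phi> n (t, g t) - (c t - f t) * \<phi> n (t, f t))"
      by (rule integral_weighted_slices[OF test_function_L2(3,4)[OF \<phi>] _ cc])
        (intro pderiv_at_snd_has_derivative test_function_L2(5)[OF \<phi>])
    \<comment> \<open>Both choices of \<open>c\<close> and \<open>e\<close> leave the same factor:
      \<open>- (g t - f t)\<close> on the graph of \<open>f\<close>, and \<open>f t - g t\<close> on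
      the graph of \<open>g\<close>.\<close>
    also have "\<dots> = (LINT t|lebesgue_on {a..b}. (f t - g t) * \<phi> n (t, e t))"
      using ce by (intro Bochner_Integration.integral_cong) (auto simp: algebra_simps)
    finally show ?thesis .
  qed
  moreover have "(\<lambda>n. LINT t|lebesgue_on {a..b}. (f t - g t) * \<phi> n (t, e t)) \<longlonglongrightarrow> 0"
  proof -
    obtain W where "\<forall>t\<in>{a..b}. \<bar>f t - g t\<bar> \<le> W"
      using width_bounded_measurable(2) by blast
    then have W: "\<And>t. t \<in> space (lebesgue_on {a..b}) \<Longrightarrow> \<bar>f t - g t\<bar> \<le> W"
      by simp
    have "finite_measure (lebesgue_on {a..b})"
      by (intro finite_measure_lebesgue_on) simp
    moreover have "(\<lambda>_. 0) \<in> L2 (lebesgue_on {a..b})" by (simp add: L2_def)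
    moreover have "(\<lambda>n. LINT t|lebesgue_on {a..b}. (\<phi> n (t, e t) - 0)\<^sup>2) \<longlonglongrightarrow> 0"
      using lim(3) by simp
    ultimately have "(\<lambda>n. LINT t|lebesgue_on {a..b}. (f t - g t) * \<phi> n (t, e t))
        \<longlonglongrightarrow> (LINT t|lebesgue_on {a..b}. (f t - g t) * 0)"
      by (rule L2_tendsto_bounded[OF _ graph_L2[OF \<phi> contE] _ _ width_bounded_measurable(1) W])
    then show ?thesis by simp
  qed
  ultimately have "(\<lambda>n. LINT x|lebesgue_on \<omega>. ?q x * pderiv_at (0, 1) (\<phi> n) x - \<phi> n x) \<longlonglongrightarrow> 0"
    by simp
  moreover have "(\<lambda>n. LINT x|lebesgue_on \<omega>. ?q x * pderiv_at (0, 1) (\<phi> n) x - \<phi> n x)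
      \<longlonglongrightarrow> (LINT x|lebesgue_on \<omega>. ?q x * D2 u x - u x)"
  proof -
    have 1: "(\<lambda>n. LINT x|lebesgue_on \<omega>. ?q x * pderiv_at (0, 1) (\<phi> n) x) \<longlonglongrightarrow> (LINT x|lebesgue_on \<omega>. ?q x * D2 u x)"
      by (rule L2_tendsto_bounded[OF finite_measure_\<omega> test_function_L2(2)[OF \<phi>] L2(2) lim(2) q])
    have 2: "(\<lambda>n. LINT x|lebesgue_on \<omega>. 1 * \<phi> n x) \<longlonglongrightarrow> (LINT x|lebesgue_on \<omega>. 1 * u x)"
      by (rule L2_tendsto_bounded[OF finite_measure_\<omega> test_function_L2(1)[OF \<phi>] L2(1) lim(1), where B = 1]) auto
    show ?thesis
      using tendsto_diff[OF 1 2] int[OF test_function_L2(2)[OF \<phi>] test_function_L2(1)[OF \<phi>]] int[OF L2(2) L2(1)] by simp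
  qed
  ultimately show "(LINT x|lebesgue_on \<omega>. ?q x * D2 u x - u x) = 0"
    by (rule LIMSEQ_unique[rotated])
qed

text \<open>Subtracting the two weighted identities cancels \<open>u\<close> and the coordinate
  \<open>snd x\<close>, so each trace may keep its own approximating sequence. The remaining factor
  \<open>f - g\<close> is negative, so the integrand is nonnegative with integral 0.\<close>

lemma D2_zero:
  assumes tr: "has_trace \<omega> (graph_measure a b f) u (\<lambda>_. 0)" "has_trace \<omega> (graph_measure a b g) u (\<lambda>_. 0)"
    and L: "L-lipschitz_on {a..b} f" "L'-lipschitz_on {a..b} g"
    and nonpos: "AE x in lebesgue_on \<omega>. D2 u x \<le> 0"
  shows "AE x in lebesgue_on \<omega>. D2 u x = 0"
proof -
  let ?h = "\<lambda>x. (f (fst x) - g (fst x)) * D2 u x"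
  note F = zero_trace_weighted_integral[OF tr(1) L(1), where c = g, simplified]
  note G = zero_trace_weighted_integral[OF tr(2) L(2), where c = f, simplified]
  have h: "?h = (\<lambda>x. ((f (fst x) - snd x) * D2 u x - u x) - ((g (fst x) - snd x) * D2 u x - u x))"
    by (simp add: algebra_simps fun_eq_iff)
  have int: "integrable (lebesgue_on \<omega>) ?h"
    unfolding h by (rule Bochner_Integration.integrable_diff[OF G(1) F(1)])
  have zero: "(LINT x|lebesgue_on \<omega>. ?h x) = 0"
    unfolding h Bochner_Integration.integral_diff[OF G(1) F(1)] by (simp only: F(2) G(2) diff_self)
  have neg: "f (fst x) - g (fst x) < 0" if "x \<in> space (lebesgue_on \<omega>)" for x
    using f_less_g[OF fst_in_interval] that by simp
  have "AE x in lebesgue_on \<omega>. 0 \<le> ?h x"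
    using nonpos AE_space
    by eventually_elim (intro mult_nonpos_nonpos less_imp_le[OF neg])
  then have "AE x in lebesgue_on \<omega>. ?h x = 0"
    using integral_nonneg_eq_0_iff_AE[OF int] zero by simp
  then show ?thesis
    using AE_space by eventually_elim (use neg in force)
qed

text \<open>This is a Poincare argument with weight \<open>g - y\<close>. The slice identity is
  applied to the squares of the approximants, so that all products are smooth before the limit is
  taken.\<close>

lemma zero_trace_D2_zero:
  assumes tr: "has_trace \<omega> (graph_measure a b f) u (\<lambda>_. 0)" and L: "L-lipschitz_on {a..b} f"
    and D2: "AE x in lebesgue_on \<omega>. D2 u x = 0"
  shows "AE x in lebesgue_on \<omega>. u x = 0"
proof -
  obtain \<phi> where \<phi>: "\<And>n. \<phi> n \<in> test_functions UNIV"
    and L2: "u \<in> L2 (lebesgue_on \<omega>)" "D2 u \<in> L2 (lebesgue_on \<omega>)"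
    and lim: "(\<lambda>n. LINT x|lebesgue_on \<omega>. (\<phi> n x - u x)\<^sup>2) \<longlonglongrightarrow> 0"
      "(\<lambda>n. LINT x|lebesgue_on \<omega>. (pderiv_at (0, 1) (\<phi> n) x - D2 u x)\<^sup>2) \<longlonglongrightarrow> 0"
      "(\<lambda>n. LINT t|lebesgue_on {a..b}. (\<phi> n (t, f t))\<^sup>2) \<longlonglongrightarrow> 0"
    by (rule has_trace_zeroE[OF tr L ab], rule that)
  let ?q = "\<lambda>x. g (fst x) - snd x"
  let ?d = "\<lambda>n. pderiv_at (0, 1) (\<phi> n)"
  obtain B where B: "\<And>x. x \<in> space (lebesgue_on \<omega>) \<Longrightarrow> \<bar>?q x\<bar> \<le> B"
    using weight_bounded_measurable(2)[OF cont_g] by auto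
  note q = weight_bounded_measurable(1)[OF cont_g] B
  note T = test_function_L2[OF \<phi>]
  \<comment> \<open>The identity is solved for the integral of the square; the boundary term on the
    graph of \<open>g\<close> is absent because the weight vanishes there.\<close>
  have eq: "(LINT x|lebesgue_on \<omega>. \<phi> n x * \<phi> n x)
      = 2 * (LINT x|lebesgue_on \<omega>. ?q x * (\<phi> n x * ?d n x))
        - (LINT t|lebesgue_on {a..b}. (f t - g t) * (\<phi> n (t, f t) * \<phi> n (t, f t)))" for n
  proof -
    have "(LINT x|lebesgue_on \<omega>. ?q x * (2 * \<phi> n x * ?d n x) - \<phi> n x * \<phi> n x)
        = (LINT t|lebesgue_on {a..b}. (g t - g t) * (\<phi> n (t, g t) * \<phi> n (t, g t))
            - (g t - f t) * (\<phi> n (t, f t) * \<phi> n (t, f t)))"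
    proof (rule integral_weighted_slices[OF _ _ _ cont_g])
      show "((\<lambda>y. \<phi> n (t, y) * \<phi> n (t, y)) has_real_derivative 2 * \<phi> n (t, y) * ?d n (t, y)) (at y)" for t y
        by (rule derivative_eq_intros pderiv_at_snd_has_derivative T refl)+ simp
    qed (intro continuous_intros T)+
    moreover have "integrable (lebesgue_on \<omega>) (\<lambda>x. ?q x * (\<phi> n x * ?d n x))"
      using L2_integrable_mult[OF L2_bounded_mult[OF T(1) q] T(2), of n] by (simp add: mult.assoc)
    then have "(LINT x|lebesgue_on \<omega>. ?q x * (2 * \<phi> n x * ?d n x) - \<phi> n x * \<phi> n x)
        = 2 * (LINT x|lebesgue_on \<omega>. ?q x * (\<phi> n x * ?d n x)) - (LINT x|lebesgue_on \<omega>. \<phi> n x * \<phi> n x)"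
      using L2_integrable_mult[OF T(1,1), of n] by (simp add: mult.assoc mult.left_commute[of _ 2])
    moreover have "(LINT t|lebesgue_on {a..b}. (g t - g t) * (\<phi> n (t, g t) * \<phi> n (t, g t))
            - (g t - f t) * (\<phi> n (t, f t) * \<phi> n (t, f t)))
        = (LINT t|lebesgue_on {a..b}. (f t - g t) * (\<phi> n (t, f t) * \<phi> n (t, f t)))"
      by (intro Bochner_Integration.integral_cong) (auto simp: algebra_simps)
    ultimately show ?thesis by linarith
  qed
  have "(\<lambda>n. LINT x|lebesgue_on \<omega>. ?q x * (\<phi> n x * ?d n x)) \<longlonglongrightarrow> (LINT x|lebesgue_on \<omega>. ?q x * (u x * D2 u x))"
    by (rule L2_tendsto_bounded_mult[OF T(1) L2(1) lim(1) T(2) L2(2) lim(2) q])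
  also have "(LINT x|lebesgue_on \<omega>. ?q x * (u x * D2 u x)) = 0"
    by (rule integral_eq_zero_AE) (use D2 in eventually_elim, simp)
  finally have 1: "(\<lambda>n. LINT x|lebesgue_on \<omega>. ?q x * (\<phi> n x * ?d n x)) \<longlonglongrightarrow> 0" .
  \<comment> \<open>The boundary term is a weighted product of two sequences that tend to 0 in
    \<open>L2\<close>.\<close>
  have 2: "(\<lambda>n. LINT t|lebesgue_on {a..b}. (f t - g t) * (\<phi> n (t, f t) * \<phi> n (t, f t))) \<longlonglongrightarrow> 0"
  proof -
    obtain W where "\<forall>t\<in>{a..b}. \<bar>f t - g t\<bar> \<le> W"
      using width_bounded_measurable(2) by blast
    then have W: "\<And>t. t \<in> space (lebesgue_on {a..b}) \<Longrightarrow> \<bar>f t - g t\<bar> \<le> W"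
      by simp
    have z: "(\<lambda>_. 0) \<in> L2 (lebesgue_on {a..b})" by (simp add: L2_def)
    have l: "(\<lambda>n. LINT t|lebesgue_on {a..b}. (\<phi> n (t, f t) - 0)\<^sup>2) \<longlonglongrightarrow> 0" using lim(3) by simp
    have G: "(\<lambda>t. \<phi> n (t, f t)) \<in> L2 (lebesgue_on {a..b})" for n by (rule graph_L2[OF \<phi> cont_f])
    from L2_tendsto_bounded_mult[OF G z l G z l width_bounded_measurable(1) W]
    show ?thesis by simp
  qed
  have "(\<lambda>n. LINT x|lebesgue_on \<omega>. \<phi> n x * \<phi> n x) \<longlonglongrightarrow> 2 * 0 - 0"
    unfolding eq by (intro tendsto_intros 1 2)
  moreover have "(\<lambda>n. LINT x|lebesgue_on \<omega>. \<phi> n x * \<phi> n x) \<longlonglongrightarrow> (LINT x|lebesgue_on \<omega>. u x * u x)"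
    by (rule L2_tendsto_mult[OF T(1) L2(1) lim(1) T(1) L2(1) lim(1)])
  ultimately have "(LINT x|lebesgue_on \<omega>. u x * u x) = 2 * 0 - 0"
    by (rule LIMSEQ_unique[rotated])
  then show ?thesis
    using integral_nonneg_eq_0_iff_AE[OF L2_integrable_mult[OF L2(1) L2(1)]] by simp
qed

text \<open>The sequence behind the trace tends to \<open>u\<close>, hence to 0, while its
  horizontal derivatives tend to \<open>D1 u\<close>. Closability then forces this limit to vanish,
  whichever representative \<open>weak_pderiv\<close> has chosen.\<close>

lemma zero_trace_D1_zero:
  assumes tr: "has_trace \<omega> (graph_measure a b f) u (\<lambda>_. 0)" and L: "L-lipschitz_on {a..b} f"
    and u: "AE x in lebesgue_on \<omega>. u x = 0"
  shows "AE x in lebesgue_on \<omega>. D1 u x = 0"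
proof -
  obtain \<phi> where \<phi>: "\<And>n. \<phi> n \<in> test_functions UNIV"
    and L2: "u \<in> L2 (lebesgue_on \<omega>)" "D1 u \<in> L2 (lebesgue_on \<omega>)"
    and lim: "(\<lambda>n. LINT x|lebesgue_on \<omega>. (\<phi> n x - u x)\<^sup>2) \<longlonglongrightarrow> 0"
      "(\<lambda>n. LINT x|lebesgue_on \<omega>. (pderiv_at (1, 0) (\<phi> n) x - D1 u x)\<^sup>2) \<longlonglongrightarrow> 0"
    by (rule has_trace_zeroE[OF tr L ab], rule that)
  have "(LINT x|lebesgue_on \<omega>. (\<phi> n x - u x)\<^sup>2) = (LINT x|lebesgue_on \<omega>. (\<phi> n x)\<^sup>2)" for n
  proof (rule integral_cong_AE)
    show "AE x in lebesgue_on \<omega>. (\<phi> n x - u x)\<^sup>2 = (\<phi> n x)\<^sup>2"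
      using u by eventually_elim simp
  qed (use L2_measurable[OF L2(1)] L2_measurable[OF test_function_L2(1)[OF \<phi>]] in auto)
  then have "(\<lambda>n. LINT x|lebesgue_on \<omega>. (\<phi> n x)\<^sup>2) \<longlonglongrightarrow> 0" using lim(1) by simp
  then show ?thesis
    by (rule pderiv_limit_zero[OF bounded_\<omega> open_\<omega> \<phi> _ L2(2) lim(2)])
qed

lemma strain_zero_rigid:
  assumes L: "L-lipschitz_on {a..b} f" "L'-lipschitz_on {a..b} g"
    and tr: "\<And>\<alpha>. has_trace \<omega> (graph_measure a b f) (uH \<alpha>) (\<lambda>_. 0)"
      "\<And>\<alpha>. has_trace \<omega> (graph_measure a b g) (uH \<alpha>) (\<lambda>_. 0)"
    and E: "AE y in lebesgue_on \<omega>. strain \<omega> (uH, u3) y = 0"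
  shows "AE y in lebesgue_on \<omega>. uH \<alpha> y = 0" "AE y in lebesgue_on \<omega>. weak_d \<omega> \<alpha> u3 y = 0"
proof -
  let ?u = "uH 1" and ?v = "uH 2"
  have dir: "unit_dir 1 = (1, 0)" "unit_dir 2 = (0, 1)" by (simp_all add: unit_dir_def)
  \<comment> \<open>These are the two diagonal entries and the shear entry of the strain, the latter
    multiplied by 2.\<close>
  have E': "AE y in lebesgue_on \<omega>. D1 ?u y = - (D1 u3 y)\<^sup>2 / 2 \<and> D2 ?v y = - (D2 u3 y)\<^sup>2 / 2
      \<and> D1 ?v y + D2 ?u y + D1 u3 y * D2 u3 y = 0"
    using E
  proof eventually_elim
    case (elim y)
    then have "strain \<omega> (uH, u3) y $ \<alpha> $ \<beta> = 0" for \<alpha> \<beta> by simp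
    from this[of 1 1] this[of 2 2] this[of 1 2] show ?case
      by (simp add: strain_def dir power2_eq_square)
  qed
  \<comment> \<open>The second diagonal equation equates \<open>D2 ?v\<close> with minus half a
    square, which supplies the sign condition.\<close>
  have "AE y in lebesgue_on \<omega>. D2 ?v y = 0"
    by (rule D2_zero[OF tr L]) (use E' in eventually_elim, simp)
  note v2 = this zero_trace_D2_zero[OF tr(1) L(1) this]
  \<comment> \<open>\<open>D1 ?v\<close> must vanish as well before the shear equation isolates
    \<open>D2 ?u\<close>.\<close>
  note v1 = zero_trace_D1_zero[OF tr(1) L(1) v2(2)]
  have w2: "AE y in lebesgue_on \<omega>. D2 u3 y = 0"
    using E' v2(1) by eventually_elim simp
  have "AE y in lebesgue_on \<omega>. D2 ?u y = 0"
    using E' v1 w2 by eventually_elim simp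
  note u = zero_trace_D2_zero[OF tr(1) L(1) this]
  have w1: "AE y in lebesgue_on \<omega>. D1 u3 y = 0"
    using E' zero_trace_D1_zero[OF tr(1) L(1) u] by eventually_elim simp
  show "AE y in lebesgue_on \<omega>. uH \<alpha> y = 0" "AE y in lebesgue_on \<omega>. weak_d \<omega> \<alpha> u3 y = 0"
    using exhaust_2[of \<alpha>] u v2(2) w1 w2 by (auto simp: dir)
qed

end

theorem theorem5:
  fixes a b :: real and f g :: "real \<Rightarrow> real"
    and \<omega> :: "(real \<times> real) set"
    and VH :: "(2 \<Rightarrow> real \<times> real \<Rightarrow> real) set"
    and V3 :: "(real \<times> real \<Rightarrow> real) set"
    and V :: "((2 \<Rightarrow> real \<times> real \<Rightarrow> real) \<times> (real \<times> real \<Rightarrow> real)) set"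
  assumes "a < b"
    and "\<exists>L. L-lipschitz_on {a..b} f"
    and "\<exists>L. L-lipschitz_on {a..b} g"
    and "\<And>t. t \<in> {a..b} \<Longrightarrow> f t < g t"
    and "\<omega> = rectangle_like a b f g"
    and "VH \<subseteq> {uH. \<forall>\<alpha>. uH \<alpha> \<in> sobolev_H 1 \<omega>}"
    and "V3 \<subseteq> sobolev_H 2 \<omega>"
    and "V = VH \<times> V3"
    and "\<And>u3. u3 \<in> V3 \<Longrightarrow> (\<forall>\<alpha>. AE y in lebesgue_on \<omega>. weak_d \<omega> \<alpha> u3 y = 0)
           \<Longrightarrow> AE y in lebesgue_on \<omega>. u3 y = 0"
    and "\<And>uH \<alpha>. uH \<in> VH \<Longrightarrow>
           has_trace \<omega> (graph_measure a b f) (uH \<alpha>) (\<lambda>_. 0) \<and>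
           has_trace \<omega> (graph_measure a b g) (uH \<alpha>) (\<lambda>_. 0)"
  shows "\<forall>(uH, u3) \<in> V. (AE y in lebesgue_on \<omega>. strain \<omega> (uH, u3) y = 0) \<longrightarrow>
           (\<forall>\<alpha>. AE y in lebesgue_on \<omega>. uH \<alpha> y = 0) \<and> (AE y in lebesgue_on \<omega>. u3 y = 0)"
proof clarify
  obtain L L' where L: "L-lipschitz_on {a..b} f" "L'-lipschitz_on {a..b} g"
    using assms(2,3) by blast
  interpret graph_domain a b f g \<omega>
    using assms(1,4,5) L lipschitz_on_continuous_on by unfold_locales auto
  fix uH u3
  assume "(uH, u3) \<in> V" and E: "AE y in lebesgue_on \<omega>. strain \<omega> (uH, u3) y = 0"
  then have u: "uH \<in> VH" "u3 \<in> V3" using assms(8) by auto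
  \<comment> \<open>Vanishing strain and traces give \<open>uH = 0\<close> and a vanishing gradient
    of \<open>u3\<close>; the assumption on \<open>V3\<close> then yields
    \<open>u3 = 0\<close>.\<close>
  note rigid = strain_zero_rigid[OF L _ _ E]
  show "(\<forall>\<alpha>. AE y in lebesgue_on \<omega>. uH \<alpha> y = 0) \<and> (AE y in lebesgue_on \<omega>. u3 y = 0)"
    using rigid assms(10)[OF u(1)] assms(9)[OF u(2)] by blast
qed

end
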